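(* Let $d>0$ be fixed, let $N$ be the number of triangles in $G_n=\mathcal{G}(n,\frac dn)$, and let $k=k_n$ be a sequence of positive integers which is (weakly) increasing in $n$. 1. There exists a constant $c>0$ depending only on $d$ such that the following holds. Let $\delta>0$ be a sufficiently small constant. Suppose that $k^{1/3}\log k<\big((\frac{3}{\sqrt2})^{2/3}-\delta\big)\log n$. Then, for sufficiently large $n$, $$e^{-k\log k-ck}\le \mathbb{P}(N\ge k)\le e^{-k\log k+ck}.$$ 2. Let $\delta>0$ and $0<\mu<\frac1{10}$ be constants. Suppose that $k^{1/3}\log k>\big((\frac{3}{\sqrt2})^{2/3}+\delta\big)\log n$ and $k\le n^{\frac1{10}-\mu}$. Then, for any $\varepsilon>0$ and sufficiently large $n$, $$n^{-\left((\frac{3}{\sqrt2})^{2/3}+\varepsilon\right)k^{2/3}}\le\mathbb{P}(N\ge k)\le n^{-\left((\frac{3}{\sqrt2})^{2/3}-\varepsilon\right)k^{2/3}}.$$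
   Context: $\mathcal{G}(n,p)$ denotes the Erdős–Rényi random graph on $n$ vertices, in which each of the $\binom n2$ possible edges is present independently with probability $p$ (here $p=d/n$, with $n$ large enough that $d/n\le1$). $N$ counts unordered triples of vertices all of whose three pairs are edges. $\log$ is the natural logarithm. *)

theory Defs
  imports "HOL-Probability.Probability"
begin

definition pairs :: "'a set \<Rightarrow> 'a set set" where
  "pairs V = {e. e \<subseteq> V \<and> card e = 2}"

text \<open>The random graph on the vertex set \<open>{..<n}\<close>, represented by its set of edges.
  Since \<open>bernoulli_pmf\<close> clamps its parameter to \<open>[0, 1]\<close>, this is total in \<open>p\<close>; it is
  the Erdos-Renyi graph when \<open>0 \<le> p \<le> 1\<close>.\<close>

definition gnp :: "nat \<Rightarrow> real \<Rightarrow> nat set set pmf" where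
  "gnp n p = map_pmf (\<lambda>f. {e \<in> pairs {..<n}. f e})
     (Pi_pmf (pairs {..<n}) False (\<lambda>_. bernoulli_pmf p))"

definition num_triangles :: "'a set \<Rightarrow> 'a set set \<Rightarrow> nat" where
  "num_triangles V G = card {T. T \<subseteq> V \<and> card T = 3 \<and> pairs T \<subseteq> G}"

definition prob_triangles_ge :: "nat \<Rightarrow> real \<Rightarrow> nat \<Rightarrow> real" where
  "prob_triangles_ge n p k = measure_pmf.prob (gnp n p) {G. num_triangles {..<n} G \<ge> k}"

end

theory Submission
  imports Defs "HOL-Real_Asymp.Real_Asymp"
begin

text \<open>
  Write \<open>p = d / n\<close>, \<open>z = k powr (1/3)\<close> and let \<open>C = (3 / sqrt 2) powr (2/3)\<close>, so that \<open>C ^ 3 = 9/2\<close>.  There are two cheap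
  ways to create \<open>k\<close> triangles: \<open>k\<close> vertex-disjoint triangles, at a cost \<open>exp (- k ln k + O(k))\<close>, and
  one clique on about \<open>6 powr (1/3) * z\<close> vertices, which has about \<open>C z\<^sup>2\<close> edges and costs about
  \<open>n powr (- C z\<^sup>2)\<close>.  The threshold \<open>z ln k = C ln n\<close> is where the two costs agree.

  \<^bold>\<open>Upper bound.\<close>  Split the triangles of the graph into the \<open>j\<close> isolated ones, which share no vertex
  with another triangle, and a clustered family of at least \<open>m = k - j\<close> triangles
  (\<open>triangle_decomposition\<close>).  The isolated triangles are edge-disjoint from the clusters,
  so by a union bound the joint probability is at most \<open>(d ^ 3) ^ j / j! * w(m)\<close>, where
  \<open>w(m) = (\<Sum>H. p ^ card H)\<close> runs over any set of graphs one of which must occur inside a clustered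
  family of \<open>m\<close> triangles.  If \<open>w(m) \<le> exp (- m r)\<close> for all \<open>m \<le> k\<close>, summing the exponential series
  over \<open>j\<close> gives \<open>P(N \<ge> k) \<le> exp (- k r + d ^ 3 exp r)\<close> (\<open>prob_triangles_le_exp\<close>).
  The theorem takes \<open>r = ln k\<close> in the first regime and \<open>r = (C - \<epsilon>) ln n / z\<close> in the second one.

  The graphs \<open>H\<close> come from two mechanisms.  Call edges minus vertices the excess of a
  family of triangles; a graph of excess \<open>x\<close> costs \<open>n powr (- x)\<close>, up to the number of its shapes.
  A clustered family can be built up so that the excess pays for the edges at each step: at most six edges per
  unit of excess (\<open>cluster_step\<close>).  Hence either the family contains a graph whose
  excess is within \<open>2\<close> of a prescribed \<open>x\<close> and whose number of edges is at most \<open>6 (x + 2)\<close>, or the family itself has at most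
  \<open>6 x\<close> edges (\<open>cluster_dichotomy\<close>).  Take \<open>x\<close> about \<open>20 m powr (2/3)\<close>.  The first alternative has
  negligible weight: the number of shapes is at most about \<open>x ^ (12 x)\<close>, which is beaten by \<open>n ^ x\<close> because
  \<open>k \<le> n powr (1/10)\<close> makes \<open>x ^ 12\<close> smaller than \<open>n powr (4/5)\<close> up to constants.  In the second alternative, deleting edges that lie
  in few triangles leaves a core that has almost all triangles but only \<open>O(m powr (1/3))\<close> vertices (\<open>exists_core\<close>),
  so that choosing its vertices and its shape is of lower order.  The core has at least
  \<open>C ((1 - \<eta>) m) powr (2/3)\<close> edges, because a graph with \<open>e\<close> edges has at most \<open>sqrt 2 / 3 * e powr (3/2)\<close> triangles
  (\<open>card_triples_le\<close>).

  \<^bold>\<open>Lower bounds.\<close>  The clique bound is immediate.  For disjoint triangles, consider three blocks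
  of \<open>w\<close> vertices, a small constant fraction of \<open>n\<close>, and for every set \<open>J\<close> of \<open>k\<close> disjoint transversal
  triangles the event that the transversal triangles of the graph are exactly \<open>J\<close>.  These events are
  disjoint, each has probability at least \<open>p ^ (3 k) / 2\<close> by a union bound over the other
  triangles, and there are at least \<open>(w ^ 3 / (4 k)) ^ k\<close> of them.
\<close>

section \<open>Random edges\<close>

lemma finite_pairs [simp]: "finite V \<Longrightarrow> finite (pairs V)"
  unfolding pairs_def by (rule finite_subset[of _ "Pow V"]) auto

lemma card_pairs: "finite V \<Longrightarrow> card (pairs V) = card V choose 2"
  unfolding pairs_def by (rule n_subsets)

lemma pairs_mono: "V \<subseteq> W \<Longrightarrow> pairs V \<subseteq> pairs W"
  unfolding pairs_def by auto

lemma pairs_Int: "pairs V \<inter> pairs W = pairs (V \<inter> W)"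
  unfolding pairs_def by auto

lemma prob_gnp_superset:
  assumes "0 \<le> p" "p \<le> 1" "F \<subseteq> pairs {..<n}"
  shows "measure_pmf.prob (gnp n p) {G. F \<subseteq> G} = p ^ card F"
proof -
  let ?A = "pairs {..<n}"
  let ?B = "\<lambda>e. if e \<in> F then {True} else UNIV"
  have "measure_pmf.prob (gnp n p) {G. F \<subseteq> G}
      = measure_pmf.prob (Pi_pmf ?A False (\<lambda>_. bernoulli_pmf p)) {f. \<forall>e\<in>F. f e}"
    unfolding gnp_def measure_map_pmf using assms(3)
    by (intro arg_cong[where f = "measure_pmf.prob _"]) auto
  also have "\<dots> = measure_pmf.prob (Pi_pmf ?A False (\<lambda>_. bernoulli_pmf p)) (PiE_dflt ?A False ?B)"
    using assms(3) by (intro measure_eq_AE AE_pmfI) (auto simp: set_Pi_pmf PiE_dflt_def split: if_splits)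
  also have "\<dots> = (\<Prod>e\<in>?A. measure_pmf.prob (bernoulli_pmf p) (?B e))"
    by (rule measure_Pi_pmf_PiE_dflt) simp
  also have "\<dots> = (\<Prod>e\<in>?A. if e \<in> F then p else 1)"
    using assms(1,2) by (intro prod.cong) (auto simp: measure_pmf_single)
  also have "\<dots> = (\<Prod>e\<in>F. p)"
    using assms(3) by (subst prod.inter_restrict[symmetric]) (auto simp: Int_absorb1)
  finally show ?thesis by simp
qed

lemma prob_gnp_union_bound:
  assumes "0 \<le> p" "p \<le> 1" "finite I" "\<And>i. i \<in> I \<Longrightarrow> F i \<subseteq> pairs {..<n}"
    and "A \<subseteq> (\<Union>i\<in>I. {G. F i \<subseteq> G})"
  shows "measure_pmf.prob (gnp n p) A \<le> (\<Sum>i\<in>I. p ^ card (F i))"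
proof -
  have "measure_pmf.prob (gnp n p) A \<le> measure_pmf.prob (gnp n p) (\<Union>i\<in>I. {G. F i \<subseteq> G})"
    using assms(5) by (intro measure_pmf.finite_measure_mono) auto
  also have "\<dots> \<le> (\<Sum>i\<in>I. measure_pmf.prob (gnp n p) {G. F i \<subseteq> G})"
    using assms(3) by (intro measure_pmf.finite_measure_subadditive_finite) auto
  also have "\<dots> = (\<Sum>i\<in>I. p ^ card (F i))"
    using assms by (intro sum.cong prob_gnp_superset) auto
  finally show ?thesis .
qed

section \<open>Families of triples\<close>

definition edges :: "'a set set \<Rightarrow> 'a set set" where
  "edges T = (\<Union>t\<in>T. pairs t)"

definition triples :: "'a set set \<Rightarrow> bool" where
  "triples T \<longleftrightarrow> finite T \<and> (\<forall>t\<in>T. card t = 3)"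

lemma triples_subset: "triples T \<Longrightarrow> S \<subseteq> T \<Longrightarrow> triples S"
  unfolding triples_def by (auto intro: finite_subset)

lemma triples_finite_elem: "triples T \<Longrightarrow> t \<in> T \<Longrightarrow> finite t"
  unfolding triples_def by (metis card.infinite zero_neq_numeral)

lemma finite_Union_triples: "triples T \<Longrightarrow> finite (\<Union>T)"
  using triples_finite_elem by (auto simp: triples_def)

lemma finite_edges: "triples T \<Longrightarrow> finite (edges T)"
  using triples_finite_elem[of T] unfolding edges_def by (auto simp: triples_def)

lemma edges_mono: "S \<subseteq> T \<Longrightarrow> edges S \<subseteq> edges T"
  unfolding edges_def by auto

lemma edges_subset_pairs: "\<Union>T \<subseteq> V \<Longrightarrow> edges T \<subseteq> pairs V"
  unfolding edges_def pairs_def by auto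

lemma pair_in_triple:
  assumes "card t = 3" "v \<in> t"
  shows "t - {v} \<in> pairs t"
  using assms by (auto simp: pairs_def card_Diff_singleton)

lemma pairs_remove: "triples T \<Longrightarrow> t \<in> T \<Longrightarrow> v \<in> t \<Longrightarrow> t - {v} \<in> edges T"
  using pair_in_triple[of t v] unfolding edges_def triples_def by blast

lemma Union_pairs_triple:
  assumes "card t = 3"
  shows "\<Union>(pairs t) = t"
proof -
  obtain a b c where t: "t = {a, b, c}" "a \<noteq> b" "b \<noteq> c" "a \<noteq> c"
    using assms by (auto simp: card_3_iff)
  have "{a,b} \<in> pairs t" "{b,c} \<in> pairs t" using t by (auto simp: pairs_def)
  then have "t \<subseteq> \<Union>(pairs t)" using t(1) by blast
  moreover have "\<Union>(pairs t) \<subseteq> t" by (auto simp: pairs_def)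
  ultimately show ?thesis by simp
qed

lemma Union_edges: "triples T \<Longrightarrow> \<Union>(edges T) = \<Union>T"
  using Union_pairs_triple by (auto simp: edges_def triples_def) blast+

text \<open>A triangle through \<open>v\<close> is determined by its two edges at \<open>v\<close>, which is how the number of triangles
  at \<open>v\<close> is compared with the degree of \<open>v\<close>.\<close>

lemma triple_star:
  assumes "card t = 3" "v \<in> t"
  shows "card {e \<in> pairs t. v \<in> e} = 2" "\<Union>{e \<in> pairs t. v \<in> e} = t"
proof -
  obtain a b where t: "t = {v, a, b}" "a \<noteq> b" "v \<noteq> a" "v \<noteq> b"
  proof -
    have "card (t - {v}) = 2" using assms by (simp add: card_Diff_singleton)
    then obtain a b where ab: "t - {v} = {a, b}" "a \<noteq> b" by (auto simp: card_2_iff)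
    with assms(2) have "t = {v, a, b}" "v \<noteq> a" "v \<noteq> b" by auto
    with ab show ?thesis using that by blast
  qed
  have "{e \<in> pairs t. v \<in> e} = {{v, a}, {v, b}}"
    unfolding t pairs_def using t(2-4) by (auto simp: card_2_iff doubleton_eq_iff) 
  then show "card {e \<in> pairs t. v \<in> e} = 2" "\<Union>{e \<in> pairs t. v \<in> e} = t"
    using t by (auto simp: doubleton_eq_iff)
qed

text \<open>Double counting of incidences between vertices and triangles, and between vertices and edges.\<close>

lemma sum_degrees:
  assumes "triples T"
  shows "(\<Sum>v\<in>\<Union>T. card {t \<in> T. v \<in> t}) = 3 * card T"
    and "(\<Sum>v\<in>\<Union>T. card {e \<in> edges T. v \<in> e}) = 2 * card (edges T)"
proof -
  have "{v \<in> \<Union>T. v \<in> t} = t" if "t \<in> T" for t using that by auto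
  then show "(\<Sum>v\<in>\<Union>T. card {t \<in> T. v \<in> t}) = 3 * card T"
    using assms finite_Union_triples[OF assms]
    by (subst sum_multicount_gen[where k = "\<lambda>_. 3"]) (auto simp: triples_def)
  have "card {v \<in> \<Union>T. v \<in> e} = 2" if "e \<in> edges T" for e
  proof -
    have "{v \<in> \<Union>T. v \<in> e} = e" using that by (auto simp: edges_def pairs_def)
    then show ?thesis using that by (auto simp: edges_def pairs_def)
  qed
  then show "(\<Sum>v\<in>\<Union>T. card {e \<in> edges T. v \<in> e}) = 2 * card (edges T)"
    using finite_edges[OF assms] finite_Union_triples[OF assms]
    by (subst sum_multicount_gen[where k = "\<lambda>_. 2"]) auto
qed

lemma le_mult_sqrt_half:
  fixes t d e :: nat
  assumes "t \<le> e" "t \<le> d choose 2"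
  shows "real t \<le> real d * sqrt (e / 2)"
proof -
  have "2 * t \<le> d * (d - 1)" using assms(2) by (simp add: choose_two)
  also have "\<dots> \<le> d * d" by simp
  finally have "real (2 * t) \<le> real (d * d)" by (rule of_nat_mono)
  then have "real t * (2 * real t) \<le> real e * (real d * real d)"
    using assms(1) mult_mono[of "real t" "real e" "2 * real t" "real d * real d"] by simp
  then have "real t ^ 2 \<le> real d ^ 2 * (e / 2)" by (simp add: power2_eq_square mult.commute)
  then have "real t ^ 2 \<le> (real d * sqrt (e / 2)) ^ 2" by (simp add: power_mult_distrib)
  then show ?thesis by (rule power2_le_imp_le) simp
qed

text \<open>The Kruskal--Katona bound in its real form.  The number of triangles at a vertex \<open>v\<close> of degree \<open>d\<close> is at
  most the number of edges \<open>e\<close> (take the opposite edge) and at most \<open>d choose 2\<close> (take the two edges at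
  \<open>v\<close>), hence at most the geometric mean \<open>d * sqrt (e / 2)\<close> of \<open>e\<close> and \<open>d\<^sup>2 / 2\<close>.  Summing over \<open>v\<close> gives three times the
  number of triangles on one side and \<open>2 e * sqrt (e / 2)\<close> on the other.\<close>

lemma card_triples_le:
  assumes "triples T"
  shows "9 * real (card T) ^ 2 \<le> 2 * real (card (edges T)) ^ 3"
proof -
  let ?E = "card (edges T)"
  let ?t = "\<lambda>v. card {t \<in> T. v \<in> t}" and ?d = "\<lambda>v. card {e \<in> edges T. v \<in> e}"
  have fin: "finite T" "finite (edges T)" using assms finite_edges by (auto simp: triples_def)
  have star: "real (?t v) \<le> real (?d v) * sqrt (?E / 2)" for v
  proof -
    have 1: "?t v \<le> ?E"
    proof (rule card_inj_on_le[OF _ _ fin(2)])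
      show "inj_on (\<lambda>t. t - {v}) {t \<in> T. v \<in> t}" by (intro inj_onI) blast
      show "(\<lambda>t. t - {v}) ` {t \<in> T. v \<in> t} \<subseteq> edges T" using pairs_remove[OF assms] by blast
    qed
    let ?f = "\<lambda>t. {e \<in> pairs t. v \<in> e}"
    have un: "\<Union>(?f t) = t" "card (?f t) = 2" if "t \<in> T" "v \<in> t" for t
      using assms that triple_star[of t v] unfolding triples_def by simp_all
    have "?t v \<le> card {P. P \<subseteq> {e \<in> edges T. v \<in> e} \<and> card P = 2}"
    proof (rule card_inj_on_le)
      show "inj_on ?f {t \<in> T. v \<in> t}"
      proof (rule inj_onI)
        fix s t assume st: "s \<in> {t \<in> T. v \<in> t}" "t \<in> {t \<in> T. v \<in> t}" and eq: "?f s = ?f t"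
        from st have "s = \<Union>(?f s)" "t = \<Union>(?f t)" by (auto simp only: un(1) mem_Collect_eq)
        with eq show "s = t" by argo
      qed
      show "?f ` {t \<in> T. v \<in> t} \<subseteq> {P. P \<subseteq> {e \<in> edges T. v \<in> e} \<and> card P = 2}"
        using un(2) by (auto simp: edges_def)
      show "finite {P. P \<subseteq> {e \<in> edges T. v \<in> e} \<and> card P = 2}" using fin by simp
    qed
    also have "\<dots> = ?d v choose 2" using fin by (intro n_subsets) simp
    finally have "?t v \<le> ?d v choose 2" .
    with 1 show ?thesis by (rule le_mult_sqrt_half)
  qed
  have "real (3 * card T) = (\<Sum>v\<in>\<Union>T. real (?t v))"
    unfolding sum_degrees(1)[OF assms, symmetric] by (rule of_nat_sum)
  also have "\<dots> \<le> (\<Sum>v\<in>\<Union>T. real (?d v) * sqrt (?E / 2))" by (intro sum_mono star)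
  also have "\<dots> = real (\<Sum>v\<in>\<Union>T. ?d v) * sqrt (?E / 2)"
    by (simp only: of_nat_sum sum_distrib_right)
  also have "\<dots> = (2 * real ?E) * sqrt (?E / 2)" unfolding sum_degrees(2)[OF assms] by simp
  finally have "(real (3 * card T)) ^ 2 \<le> ((2 * real ?E) * sqrt (?E / 2)) ^ 2"
    by (intro power_mono) auto
  also have "\<dots> = 2 * real ?E ^ 3"
    by (simp add: power_mult_distrib) (simp add: power2_eq_square power3_eq_cube)
  finally show ?thesis by (simp add: power_mult_distrib)
qed

text \<open>A subfamily \<open>S\<close> that maximises \<open>card S - \<theta> * card (edges S)\<close> loses at most \<open>\<theta>\<close> triangles per edge of \<open>T\<close>,
  and each of its edges lies in at least \<open>\<theta>\<close> of its triangles, as otherwise deleting those triangles would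
  increase the functional.  So all its degrees are at least \<open>\<theta>\<close>, which bounds the number of its vertices.\<close>

lemma exists_core:
  fixes \<theta> :: real
  assumes "triples T" "\<theta> > 0"
  shows "\<exists>S\<subseteq>T. real (card T) - \<theta> * card (edges T) \<le> card S \<and> \<theta> * card (\<Union>S) \<le> 2 * card (edges S)"
proof -
  define g where "g S = real (card S) - \<theta> * card (edges S)" for S :: "'a set set"
  have fT: "finite T" using assms by (simp add: triples_def)
  obtain S where S: "S \<subseteq> T" "\<And>R. R \<subseteq> T \<Longrightarrow> g R \<le> g S"
  proof -
    have "finite (g ` Pow T)" "g ` Pow T \<noteq> {}" using fT by auto
    then have "Max (g ` Pow T) \<in> g ` Pow T" by (rule Max_in)
    then obtain S where "S \<subseteq> T" "g S = Max (g ` Pow T)" by auto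
    moreover have "g R \<le> Max (g ` Pow T)" if "R \<subseteq> T" for R using fT that by (intro Max_ge) auto
    ultimately show ?thesis using that by metis
  qed
  have tS: "triples S" using assms(1) S(1) by (rule triples_subset)
  have fS: "finite S" "finite (edges S)" using tS finite_edges by (auto simp: triples_def)
  have heavy: "\<theta> \<le> card {t \<in> S. e \<in> pairs t}" if e: "e \<in> edges S" for e
  proof -
    let ?R = "S - {t \<in> S. e \<in> pairs t}"
    have "edges ?R \<subseteq> edges S - {e}" by (auto simp: edges_def)
    then have "card (edges ?R) \<le> card (edges S - {e})" using fS by (intro card_mono) auto
    then have a: "card (edges ?R) + 1 \<le> card (edges S)" using e fS by (simp add: card_gt_0_iff Suc_le_eq)
      (metis Suc_pred card_gt_0_iff empty_iff le_imp_less_Suc card_Diff_singleton)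
    have "card ?R = card S - card {t \<in> S. e \<in> pairs t}" using fS by (intro card_Diff_subset) auto
    moreover have "card {t \<in> S. e \<in> pairs t} \<le> card S" using fS by (intro card_mono) auto
    ultimately have b: "real (card ?R) = real (card S) - card {t \<in> S. e \<in> pairs t}" by simp
    have "g ?R \<le> g S" using S(1) by (intro S(2)) auto
    moreover have "\<theta> * (real (card (edges ?R)) + 1) \<le> \<theta> * card (edges S)"
      using a assms(2) by (intro mult_left_mono) linarith+
    ultimately show ?thesis unfolding g_def b by (simp add: algebra_simps)
  qed
  have deg: "\<theta> \<le> card {e \<in> edges S. v \<in> e}" if "v \<in> \<Union>S" for v
  proof -
    have "v \<in> \<Union>(edges S)" using that Union_edges[OF tS] by simp
    then obtain e where e: "e \<in> edges S" "v \<in> e" by auto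
    then have "card e = 2" by (auto simp: edges_def pairs_def)
    then obtain u where u: "e = {u, v}" "u \<noteq> v" using e(2) by (auto simp: card_2_iff)
    have "card {t \<in> S. e \<in> pairs t} \<le> card {e \<in> edges S. v \<in> e}"
    proof (rule card_inj_on_le)
      have "u \<in> t" "v \<in> t" if "e \<in> pairs t" for t using that u(1) by (auto simp: pairs_def)
      then show "inj_on (\<lambda>t. t - {u}) {t \<in> S. e \<in> pairs t}"
        and "(\<lambda>t. t - {u}) ` {t \<in> S. e \<in> pairs t} \<subseteq> {e \<in> edges S. v \<in> e}"
        using pairs_remove[OF tS] u(2) by (blast intro: inj_onI, blast)
      show "finite {e \<in> edges S. v \<in> e}" using fS by simp
    qed
    with heavy[OF e(1)] show ?thesis by linarith
  qed
  have "\<theta> * card (\<Union>S) = (\<Sum>v\<in>\<Union>S. \<theta>)" by simp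
  also have "\<dots> \<le> (\<Sum>v\<in>\<Union>S. real (card {e \<in> edges S. v \<in> e}))" by (intro sum_mono deg)
  also have "\<dots> = 2 * real (card (edges S))"
    using sum_degrees(2)[OF tS] by (metis of_nat_mult of_nat_numeral of_nat_sum)
  finally have "\<theta> * card (\<Union>S) \<le> 2 * real (card (edges S))" .
  moreover have "real (card T) - \<theta> * card (edges T) \<le> card S"
  proof -
    have "g T \<le> g S" by (intro S(2)) simp
    moreover have "0 \<le> \<theta> * card (edges S)" using assms(2) by simp
    ultimately show ?thesis unfolding g_def by linarith
  qed
  ultimately show ?thesis using S(1) by auto
qed

text \<open>The opposite of a disjoint family: none of the triangles is isolated.\<close>

definition clustered :: "'a set set \<Rightarrow> bool" where
  "clustered T \<longleftrightarrow> triples T \<and> (\<forall>t\<in>T. \<exists>t'\<in>T. t' \<noteq> t \<and> t \<inter> t' \<noteq> {})"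

lemma card_pairs_triple: "card t = 3 \<Longrightarrow> card (pairs t) = 3"
  by (subst card_pairs) (auto simp: choose_two intro: card_ge_0_finite)

text \<open>A proper subfamily can be enlarged so that its excess (edges minus vertices) grows by at most three and
  by at least one sixth of the number of new edges; the second inequality states this as
  \<open>6 * (new vertices) \<le> 5 * (new edges)\<close>.  If some further triangle meets the vertices used so far, add it: it brings at
  least as many edges as the table \<open>(2, 3), (1, 2), (0, 0)\<close> of new vertices and edges says.  Otherwise add a fresh triangle together with
  a partner that it meets, which brings five vertices and six edges or four vertices and five edges.\<close>

lemma cluster_step:
  assumes "clustered T" "S \<subset> T"
  shows "\<exists>R. S \<subset> R \<and> R \<subseteq> T \<and>
     card (edges R) + card (\<Union>S) \<le> card (edges S) + card (\<Union>R) + 3 \<and>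
     6 * card (\<Union>R) + 5 * card (edges S) \<le> 6 * card (\<Union>S) + 5 * card (edges R)"
proof -
  have tT: "triples T" using assms by (simp add: clustered_def)
  have tS: "triples S" using tT assms(2) triples_subset by blast
  have fin: "finite (\<Union>S)" "finite (edges S)" using tS finite_edges finite_Union_triples by auto
  show ?thesis
  proof (cases "\<exists>t\<in>T - S. t \<inter> \<Union>S \<noteq> {}")
    case True
    then obtain t where t: "t \<in> T" "t \<notin> S" "t \<inter> \<Union>S \<noteq> {}" by auto
    have ct: "card t = 3" "finite t" using tT t triples_finite_elem by (auto simp: triples_def)
    let ?a = "card (t \<inter> \<Union>S)"
    have "\<Union>(insert t S) = \<Union>S \<union> t" "edges (insert t S) = edges S \<union> pairs t" by (auto simp: edges_def)
    then have V: "card (\<Union>(insert t S)) + ?a = card (\<Union>S) + 3"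
      and E: "card (edges (insert t S)) + card (pairs t \<inter> edges S) = card (edges S) + 3"
      using card_Un_Int[OF fin(1) ct(2)] card_Un_Int[OF fin(2) finite_pairs[OF ct(2)]] ct card_pairs_triple[OF ct(1)]
      by (simp_all add: Int_commute)
    have "pairs t \<inter> edges S \<subseteq> pairs (t \<inter> \<Union>S)" by (auto simp: edges_def pairs_def)
    then have I: "card (pairs t \<inter> edges S) \<le> ?a choose 2"
      using ct by (metis card_mono card_pairs finite_Int finite_pairs)
    have "?a \<ge> 1" using t(3) ct by (simp add: Suc_le_eq card_gt_0_iff)
    moreover have "?a \<le> 3" using ct by (metis card_mono inf_le1)
    ultimately consider "?a = 1" | "?a = 2" | "?a = 3" by linarith
    then have "card (edges (insert t S)) + card (\<Union>S) \<le> card (edges S) + card (\<Union>(insert t S)) + 3 \<and>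
      6 * card (\<Union>(insert t S)) + 5 * card (edges S) \<le> 6 * card (\<Union>S) + 5 * card (edges (insert t S))"
      using V E I by cases (auto simp: choose_two)
    then show ?thesis using t assms(2) by (intro exI[of _ "insert t S"]) auto
  next
    case False
    from assms(2) obtain t where t: "t \<in> T" "t \<notin> S" by auto
    with assms(1) obtain u where u: "u \<in> T" "u \<noteq> t" "t \<inter> u \<noteq> {}" unfolding clustered_def by blast
    have d: "t \<inter> \<Union>S = {}" using False t by blast
    with u(3) have uS: "u \<notin> S" by auto
    with False u have d': "u \<inter> \<Union>S = {}" by blast
    have ct: "card t = 3" "finite t" "card u = 3" "finite u"
      using tT t u triples_finite_elem by (auto simp: triples_def)
    let ?R = "insert t (insert u S)" and ?b = "card (t \<inter> u)"
    have "?b \<ge> 1" using u(3) ct by (simp add: Suc_le_eq card_gt_0_iff)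
    moreover have "?b < 3"
    proof -
      have "t \<inter> u \<subset> t"
      proof (rule ccontr)
        assume "\<not> t \<inter> u \<subset> t"
        then have "t \<subseteq> u" by auto
        with ct card_subset_eq[of u t] u(2) show False by simp
      qed
      then show ?thesis using ct psubset_card_mono by metis
    qed
    ultimately have b: "?b = 1 \<or> ?b = 2" by linarith
    have 1: "card (t \<union> u) + ?b = 6" using card_Un_Int[of t u] ct by simp
    have 2: "card (pairs t \<union> pairs u) + (?b choose 2) = 6"
      using card_Un_Int[of "pairs t" "pairs u"] ct
      by (simp add: card_pairs_triple pairs_Int card_pairs)
    have "\<Union>?R = \<Union>S \<union> (t \<union> u)" "\<Union>S \<inter> (t \<union> u) = {}" using d d' by auto
    then have V: "card (\<Union>?R) = card (\<Union>S) + card (t \<union> u)"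
      using fin ct card_Un_disjoint[of "\<Union>S" "t \<union> u"] by simp
    have "edges ?R = edges S \<union> (pairs t \<union> pairs u)" by (auto simp: edges_def)
    moreover have "edges S \<inter> (pairs t \<union> pairs u) = {}"
    proof -
      have "False" if "e \<subseteq> s" "s \<in> S" "card e = 2" "e \<subseteq> t \<or> e \<subseteq> u" for e s
      proof -
        have "e \<noteq> {}" using that(3) by auto
        with that(1,2,4) d d' show False by blast
      qed
      then show ?thesis by (auto simp: edges_def pairs_def)
    qed
    ultimately have E: "card (edges ?R) = card (edges S) + card (pairs t \<union> pairs u)"
      using fin ct card_Un_disjoint[of "edges S" "pairs t \<union> pairs u"] by simp
    have "card (edges ?R) + card (\<Union>S) \<le> card (edges S) + card (\<Union>?R) + 3 \<and>
      6 * card (\<Union>?R) + 5 * card (edges S) \<le> 6 * card (\<Union>S) + 5 * card (edges ?R)"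
      using b 1 2 V E by (elim disjE) (auto simp: choose_two)
    then show ?thesis using t u assms(2) uS by (intro exI[of _ ?R]) auto
  qed
qed

text \<open>Take a maximal subfamily of excess below \<open>x\<close> that has at most six edges per unit of excess.  Either it is everything, or one
  more step brings the excess to at least \<open>x\<close>; a step adds at most three, hence the window
  from \<open>x\<close> to \<open>x + 2\<close>.  In both cases the number of edges is
  controlled by \<open>x\<close>.\<close>

lemma cluster_dichotomy:
  assumes "clustered T" "x > 0"
  shows "(card (edges T) < card (\<Union>T) + x \<and> 6 * card (\<Union>T) \<le> 5 * card (edges T)) \<or>
    (\<exists>S\<subseteq>T. card (\<Union>S) + x \<le> card (edges S) \<and> card (edges S) \<le> card (\<Union>S) + x + 2 \<and>
      6 * card (\<Union>S) \<le> 5 * card (edges S))"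
proof -
  define good where "good S \<longleftrightarrow> S \<subseteq> T \<and> card (edges S) < card (\<Union>S) + x \<and> 6 * card (\<Union>S) \<le> 5 * card (edges S)" for S
  have fT: "finite T" using assms by (simp add: clustered_def triples_def)
  have "good {}" using assms(2) by (simp add: good_def edges_def)
  moreover have "finite (Collect good)" unfolding good_def using fT by (auto intro: finite_subset[of _ "Pow T"])
  ultimately obtain S where S: "good S" "\<And>R. good R \<Longrightarrow> S \<subseteq> R \<Longrightarrow> S = R"
    using finite_has_maximal2[of "Collect good" "{}"] by auto
  show ?thesis
  proof (cases "S = T")
    case True
    then show ?thesis using S(1) by (auto simp: good_def)
  next
    case False
    then obtain R where R: "S \<subset> R" "R \<subseteq> T"
      "card (edges R) + card (\<Union>S) \<le> card (edges S) + card (\<Union>R) + 3"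
      "6 * card (\<Union>R) + 5 * card (edges S) \<le> 6 * card (\<Union>S) + 5 * card (edges R)"
      using cluster_step[OF assms(1), of S] S(1) unfolding good_def by auto
    have "\<not> good R" using S(2)[of R] R(1) by blast
    then show ?thesis using R S(1) unfolding good_def by (intro disjI2 exI[of _ R]) auto
  qed
qed

section \<open>Counting sparse clusters and cores\<close>

lemma binomial_le_power: "n choose r \<le> n ^ r"
  by (cases "r \<le> n") (auto intro: binomial_le_pow simp: binomial_eq_0)

text \<open>A graph without isolated vertices is counted through its vertex set.\<close>

lemma card_graphs_on_le:
  assumes "\<And>W. card W = v \<Longrightarrow> finite W \<Longrightarrow> card {H. H \<subseteq> pairs W \<and> P H} \<le> b"
  shows "card {H. H \<subseteq> pairs {..<n::nat} \<and> card (\<Union>H) = v \<and> P H} \<le> n ^ v * b"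
proof -
  let ?W = "{W. W \<subseteq> {..<n} \<and> card W = v}" and ?H = "\<lambda>W. {H. H \<subseteq> pairs W \<and> P H}"
  have fW: "finite W" if "W \<in> ?W" for W using that finite_subset[of W "{..<n}"] by auto
  have "H \<in> (\<Union>W\<in>?W. ?H W)" if "H \<subseteq> pairs {..<n}" "card (\<Union>H) = v" "P H" for H
    using that by (intro UN_I[of "\<Union>H"]) (auto simp: pairs_def)
  then have "{H. H \<subseteq> pairs {..<n} \<and> card (\<Union>H) = v \<and> P H} \<subseteq> (\<Union>W\<in>?W. ?H W)" by blast
  then have "card {H. H \<subseteq> pairs {..<n} \<and> card (\<Union>H) = v \<and> P H} \<le> card (\<Union>W\<in>?W. ?H W)"
  proof (rule card_mono[rotated])
    have "finite (?H W)" if "W \<in> ?W" for W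
      using fW[OF that] finite_subset[of "?H W" "Pow (pairs W)"] by auto
    moreover have "finite ?W" by simp
    ultimately show "finite (\<Union>W\<in>?W. ?H W)" by blast
  qed
  also have "\<dots> \<le> (\<Sum>W\<in>?W. card (?H W))" by (intro card_UN_le) auto
  also have "\<dots> \<le> (\<Sum>W\<in>?W. b)"
  proof (rule sum_mono)
    fix W assume W: "W \<in> ?W"
    show "card (?H W) \<le> b" by (rule assms[OF _ fW[OF W]]) (use W in simp)
  qed
  also have "\<dots> = (n choose v) * b" using n_subsets[of "{..<n}" v] by simp
  also have "\<dots> \<le> n ^ v * b" by (intro mult_right_mono binomial_le_power) simp
  finally show ?thesis .
qed

lemma choose_two_le_square: "n choose 2 \<le> n\<^sup>2"
  by (rule binomial_le_power)

lemma card_graphs_le: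
  "card {H. H \<subseteq> pairs {..<n::nat} \<and> card (\<Union>H) = v \<and> card H = e} \<le> n ^ v * (v\<^sup>2) ^ e"
proof (rule card_graphs_on_le)
  fix W :: "nat set" assume W: "card W = v" "finite W"
  have "card {H. H \<subseteq> pairs W \<and> card H = e} = (v choose 2) choose e"
    using W by (subst n_subsets) (auto simp: card_pairs)
  also have "\<dots> \<le> (v choose 2) ^ e" by (rule binomial_le_power)
  also have "\<dots> \<le> (v\<^sup>2) ^ e" by (intro power_mono choose_two_le_square) simp
  finally show "card {H. H \<subseteq> pairs W \<and> card H = e} \<le> (v\<^sup>2) ^ e" .
qed

lemma card_graphs_le_exp:
  "card {H. H \<subseteq> pairs {..<n::nat} \<and> card (\<Union>H) = v} \<le> n ^ v * 2 ^ (v\<^sup>2)"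
proof -
  have "card {H. H \<subseteq> pairs {..<n} \<and> card (\<Union>H) = v \<and> True} \<le> n ^ v * 2 ^ (v\<^sup>2)"
  proof (rule card_graphs_on_le)
    fix W :: "nat set" assume W: "card W = v" "finite W"
    have "card {H. H \<subseteq> pairs W \<and> True} = 2 ^ (v choose 2)"
      using W card_Pow[of "pairs W"] by (simp add: card_pairs Pow_def)
    also have "\<dots> \<le> 2 ^ (v\<^sup>2)" by (intro power_increasing choose_two_le_square) simp
    finally show "card {H. H \<subseteq> pairs W \<and> True} \<le> 2 ^ (v\<^sup>2)" .
  qed
  then show ?thesis by simp
qed

text \<open>The graphs of prescribed excess that the dichotomy can produce.  The last condition says that the number of edges is
  at most six times the excess, so at most \<open>6 * (x + 2)\<close>.\<close>

definition excess_graphs :: "nat \<Rightarrow> nat \<Rightarrow> nat set set set" where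
  "excess_graphs n x = {H. H \<subseteq> pairs {..<n} \<and> card (\<Union>H) + x \<le> card H \<and>
     card H \<le> card (\<Union>H) + x + 2 \<and> 6 * card (\<Union>H) \<le> 5 * card H}"

definition core_graphs :: "nat \<Rightarrow> nat \<Rightarrow> real \<Rightarrow> nat set set set" where
  "core_graphs n V E = {H. H \<subseteq> pairs {..<n} \<and> card (\<Union>H) \<le> V \<and> E \<le> real (card H)}"

lemma excess_graphs_subset: "excess_graphs n x \<subseteq> Pow (pairs {..<n})"
  unfolding excess_graphs_def by auto

lemma core_graphs_subset: "core_graphs n V E \<subseteq> Pow (pairs {..<n})"
  unfolding core_graphs_def by auto

text \<open>A graph with \<open>v\<close> vertices and \<open>e\<close> edges occurs at \<open>n ^ v\<close> places with probability \<open>(d / n) ^ e\<close>, which leaves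
  \<open>n\<close> to the power minus the excess.  The numbers \<open>v\<close> and \<open>e\<close> are at most \<open>L\<close>, and the factor \<open>(D * L\<^sup>2) ^ L\<close> pays for
  the shape of the graph and for the powers of \<open>d\<close>.\<close>

lemma sum_excess_graphs_le:
  fixes d D :: real
  assumes "0 \<le> d" "d \<le> D" "1 \<le> D" "0 < n" "L = 6 * x + 12"
  shows "(\<Sum>H\<in>excess_graphs n x. (d / n) ^ card H) \<le> (real L + 1)\<^sup>2 * (D * (real L)\<^sup>2) ^ L / real n ^ x"
proof -
  define X where "X = excess_graphs n x"
  define h where "h = (\<lambda>H::nat set set. (card (\<Union>H), card H))"
  have L1: "1 \<le> (real L)\<^sup>2" using assms(5) by (intro one_le_power) simp
  have DL: "1 \<le> D * (real L)\<^sup>2" using mult_mono[OF assms(3) L1] assms(3) by simp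
  have fX: "finite X" unfolding X_def by (rule finite_subset[OF excess_graphs_subset]) simp
  have "h ` X \<subseteq> {..L} \<times> {..L}" unfolding X_def excess_graphs_def h_def assms(5) by auto
  then have "(\<Sum>H\<in>X. (d / n) ^ card H)
      = (\<Sum>y\<in>{..L} \<times> {..L}. sum (\<lambda>H. (d / n) ^ card H) {H \<in> X. h H = y})"
    using fX by (intro sum.group[symmetric]) auto
  also have "\<dots> \<le> (\<Sum>y\<in>{..L} \<times> {..L}. (D * (real L)\<^sup>2) ^ L / real n ^ x)"
  proof (rule sum_mono)
    fix y assume "y \<in> {..L} \<times> {..L}"
    then obtain v e where y: "y = (v, e)" "v \<le> L" "e \<le> L" by auto
    let ?Y = "{H \<in> X. h H = y}"
    show "sum (\<lambda>H. (d / n) ^ card H) ?Y \<le> (D * (real L)\<^sup>2) ^ L / real n ^ x"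
    proof (cases "v + x \<le> e")
      case False
      then have "?Y = {}" by (auto simp: X_def h_def excess_graphs_def y)
      then show ?thesis using assms DL by (simp only: sum.empty) (intro divide_nonneg_nonneg, auto)
    next
      case True
      have "sum (\<lambda>H. (d / n) ^ card H) ?Y = card ?Y * (d / n) ^ e"
        by (subst sum.cong[OF refl, of _ _ "\<lambda>_. (d / n) ^ e"]) (auto simp: h_def y)
      also have "card ?Y \<le> card {H. H \<subseteq> pairs {..<n} \<and> card (\<Union>H) = v \<and> card H = e}"
        by (rule card_mono) (auto simp: X_def h_def y excess_graphs_def)
      then have "card ?Y \<le> n ^ v * (v\<^sup>2) ^ e" using card_graphs_le order_trans by blast
      then have "real (card ?Y) \<le> real (n ^ v * (v\<^sup>2) ^ e)" by (rule of_nat_mono)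
      then have "card ?Y * (d / n) ^ e \<le> real (n ^ v * (v\<^sup>2) ^ e) * (d / n) ^ e"
        using assms by (intro mult_right_mono) auto
      also have "\<dots> = (d * (real v)\<^sup>2) ^ e * (real n ^ v / real n ^ e)"
        by (simp add: power_mult_distrib power_divide)
      also have "\<dots> \<le> (D * (real L)\<^sup>2) ^ L * (1 / real n ^ x)"
      proof (intro mult_mono)
        have "(d * (real v)\<^sup>2) ^ e \<le> (D * (real L)\<^sup>2) ^ e"
          using assms y by (intro power_mono mult_mono) auto
        also have "\<dots> \<le> (D * (real L)\<^sup>2) ^ L" using DL y by (intro power_increasing) auto
        finally show "(d * (real v)\<^sup>2) ^ e \<le> (D * (real L)\<^sup>2) ^ L" .
        have "real n ^ v * real n ^ x \<le> real n ^ e"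
          using True assms(4) by (subst power_add[symmetric], intro power_increasing) auto
        then show "real n ^ v / real n ^ e \<le> 1 / real n ^ x"
          using assms(4) by (simp add: field_simps)
      qed (use assms DL in auto)
      finally show ?thesis by simp
    qed
  qed
  also have "\<dots> = (real L + 1)\<^sup>2 * (D * (real L)\<^sup>2) ^ L / real n ^ x"
    by (simp add: power2_eq_square) (simp add: algebra_simps)
  finally show ?thesis unfolding X_def .
qed

text \<open>Here the number of vertices is so small that the crude count of all graphs on them suffices, and only the
  number of edges matters for the main term.\<close>

lemma sum_core_graphs_le:
  fixes p :: real
  assumes "0 < p" "p \<le> 1" "0 < n"
  shows "(\<Sum>H\<in>core_graphs n V E. p ^ card H) \<le> (real V + 1) * real n ^ V * 2 ^ (V\<^sup>2) * p powr E"
proof -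
  let ?X = "core_graphs n V E" and ?S = "\<lambda>v. {H. H \<subseteq> pairs {..<n} \<and> card (\<Union>H) = v}"
  have "(\<Sum>H\<in>?X. p ^ card H) \<le> (\<Sum>H\<in>?X. p powr E)"
    using assms by (intro sum_mono) (auto simp: core_graphs_def powr_realpow[symmetric] intro!: powr_mono')
  also have "\<dots> = real (card ?X) * p powr E" by simp
  also have "\<dots> \<le> ((real V + 1) * real n ^ V * 2 ^ (V\<^sup>2)) * p powr E"
  proof (rule mult_right_mono)
    have "?X \<subseteq> (\<Union>v\<in>{..V}. ?S v)" by (auto simp: core_graphs_def)
    then have "card ?X \<le> card (\<Union>v\<in>{..V}. ?S v)" by (intro card_mono) auto
    also have "\<dots> \<le> (\<Sum>v\<in>{..V}. card (?S v))" by (intro card_UN_le) auto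
    also have "\<dots> \<le> (\<Sum>v\<in>{..V}. n ^ V * 2 ^ (V\<^sup>2))"
    proof (intro sum_mono)
      fix v assume v: "v \<in> {..V}"
      have "card (?S v) \<le> n ^ v * 2 ^ (v\<^sup>2)" by (rule card_graphs_le_exp)
      also have "\<dots> \<le> n ^ V * 2 ^ (V\<^sup>2)"
        using v assms(3) by (intro mult_mono power_increasing power_mono) auto
      finally show "card (?S v) \<le> n ^ V * 2 ^ (V\<^sup>2)" .
    qed
    also have "\<dots> = (V + 1) * n ^ V * 2 ^ (V\<^sup>2)" by (simp add: algebra_simps)
    finally have "real (card ?X) \<le> real ((V + 1) * n ^ V * 2 ^ (V\<^sup>2))" by (rule of_nat_mono)
    then show "real (card ?X) \<le> (real V + 1) * real n ^ V * 2 ^ (V\<^sup>2)"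
      by (simp add: algebra_simps)
  qed simp
  finally show ?thesis .
qed

section \<open>Isolated triangles and clusters\<close>

lemma triangle_decomposition:
  assumes "triples T" "k \<le> card T"
  shows "\<exists>J\<subseteq>T. card J \<le> k \<and> pairwise disjnt J \<and>
    (card J = k \<or> (\<exists>C\<subseteq>T. clustered C \<and> k - card J \<le> card C \<and> \<Union>C \<inter> \<Union>J = {}))"
proof -
  define I where "I = {t \<in> T. \<forall>t'\<in>T. t' \<noteq> t \<longrightarrow> t \<inter> t' = {}}"
  have fT: "finite T" using assms by (simp add: triples_def)
  have dI: "pairwise disjnt I" unfolding I_def pairwise_def disjnt_def by auto
  have fI: "finite I" "I \<subseteq> T" using fT by (auto simp: I_def)
  show ?thesis
  proof (cases "k \<le> card I")
    case True
    then obtain J where "J \<subseteq> I" "card J = k" by (meson obtain_subset_with_card_n)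
    then show ?thesis using dI fI by (intro exI[of _ J]) (auto intro: pairwise_subset)
  next
    case False
    have "clustered (T - I)"
      unfolding clustered_def
    proof (intro conjI ballI)
      show "triples (T - I)" using assms(1) by (rule triples_subset) simp
      fix t assume "t \<in> T - I"
      then obtain t' where t': "t \<in> T" "t' \<in> T" "t' \<noteq> t" "t \<inter> t' \<noteq> {}" by (auto simp: I_def)
      then have "t' \<notin> I" by (auto simp: I_def)
      with t' show "\<exists>t'\<in>T - I. t' \<noteq> t \<and> t \<inter> t' \<noteq> {}" by auto
    qed
    moreover have "k - card I \<le> card (T - I)" using assms(2) fI by (simp add: card_Diff_subset)
    moreover have "\<Union>(T - I) \<inter> \<Union>I = {}"
    proof -
      have "t \<inter> s = {}" if "t \<in> T - I" "s \<in> I" for t s using that unfolding I_def by blast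
      then show ?thesis by blast
    qed
    ultimately show ?thesis using False dI fI
      by (intro exI[of _ I] conjI disjI2 exI[of _ "T - I"]) auto
  qed
qed

lemma card_edges_disjoint:
  assumes "triples J" "pairwise disjnt J"
  shows "card (edges J) = 3 * card J"
proof -
  have "card (edges J) = (\<Sum>t\<in>J. card (pairs t))"
    unfolding edges_def
  proof (rule card_UN_disjoint)
    show "finite J" "\<forall>t\<in>J. finite (pairs t)"
      using assms(1) triples_finite_elem[OF assms(1)] by (auto simp: triples_def)
    show "\<forall>t\<in>J. \<forall>s\<in>J. t \<noteq> s \<longrightarrow> pairs t \<inter> pairs s = {}"
    proof (intro ballI impI)
      fix t s assume "t \<in> J" "s \<in> J" "t \<noteq> s"
      then have "t \<inter> s = {}" using assms(2) by (auto simp: pairwise_def disjnt_def)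
      then show "pairs t \<inter> pairs s = {}" by (simp add: pairs_Int) (auto simp: pairs_def)
    qed
  qed
  also have "\<dots> = (\<Sum>t\<in>J. 3)"
    using assms(1) by (intro sum.cong refl card_pairs_triple) (auto simp: triples_def)
  finally show ?thesis by simp
qed

text \<open>The union bound over the isolated triangles \<open>J\<close> and a graph \<open>H\<close> inside the clusters.  The two are edge-disjoint, so the
  probabilities multiply, and there are at most \<open>(n ^ 3) ^ j / j!\<close> sets of \<open>j\<close> triangles; this factorial is the
  source of the term \<open>k ln k\<close>.\<close>

lemma prob_triangles_le_cluster_sum:
  fixes p :: real and \<H> :: "nat \<Rightarrow> nat set set set"
  assumes p: "0 \<le> p" "p \<le> 1"
    and H0: "\<H> 0 = {{}}" and Hsub: "\<And>m. \<H> m \<subseteq> Pow (pairs {..<n})"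
    and Hex: "\<And>m C. 0 < m \<Longrightarrow> clustered C \<Longrightarrow> \<Union>C \<subseteq> {..<n} \<Longrightarrow> m \<le> card C \<Longrightarrow> \<exists>H\<in>\<H> m. H \<subseteq> edges C"
  shows "prob_triangles_ge n p k
    \<le> (\<Sum>j\<le>k. ((n * p) ^ 3) ^ j / fact j * (\<Sum>H\<in>\<H> (k - j). p ^ card H))"
proof -
  define Tr where "Tr = {t. t \<subseteq> {..<n} \<and> card t = 3}"
  define Js where "Js j = {J. J \<subseteq> Tr \<and> card J = j}" for j
  define K where "K j = {(J, H). J \<in> Js j \<and> pairwise disjnt J \<and> H \<in> \<H> (k - j) \<and> edges J \<inter> H = {}}" for j
  define F where "F = (\<lambda>(j::nat, J, H). edges J \<union> H :: nat set set)"
  have fTr: "finite Tr" unfolding Tr_def by (rule finite_subset[of _ "Pow {..<n}"]) auto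
  have trJ: "triples J" if "J \<subseteq> Tr" for J using finite_subset[OF that fTr] that by (auto simp: triples_def Tr_def)
  have fH: "finite (\<H> m)" for m using Hsub[of m] finite_subset by fastforce
  have fJs: "finite (Js j)" for j unfolding Js_def using fTr by simp
  have Ksub: "K j \<subseteq> Js j \<times> \<H> (k - j)" for j unfolding K_def by auto
  have fK: "finite (K j)" for j using Ksub fJs fH by (meson finite_SigmaI finite_subset)
  have cardJs: "real (card (Js j)) \<le> real n ^ (3 * j) / fact j" for j
  proof -
    have "card (Js j) = (n choose 3) choose j"
      unfolding Js_def using fTr by (subst n_subsets) (auto simp: Tr_def n_subsets)
    then have "card (Js j) * fact j \<le> (n choose 3) ^ j" using binomial_fact_pow by simp
    also have "\<dots> \<le> (n ^ 3) ^ j" by (intro power_mono binomial_le_power) simp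
    also have "\<dots> = n ^ (3 * j)" by (simp add: power_mult)
    finally have "real (card (Js j) * fact j) \<le> real (n ^ (3 * j))" by (rule of_nat_mono)
    then show ?thesis by (simp add: field_simps)
  qed
  have "prob_triangles_ge n p k \<le> (\<Sum>i\<in>Sigma {..k} K. p ^ card (F i))"
    unfolding prob_triangles_ge_def
  proof (rule prob_gnp_union_bound[OF p])
    show "finite (Sigma {..k} K)" using fK by auto
    show "F i \<subseteq> pairs {..<n}" if i: "i \<in> Sigma {..k} K" for i
    proof -
      obtain j J H where J: "i = (j, J, H)" "J \<subseteq> Tr" "H \<in> \<H> (k - j)"
        using i by (auto simp: K_def Js_def)
      have "edges J \<subseteq> pairs {..<n}" using J(2) by (intro edges_subset_pairs) (auto simp: Tr_def)
      then show ?thesis using J Hsub[of "k - j"] by (auto simp: F_def)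
    qed
    show "{G. k \<le> num_triangles {..<n} G} \<subseteq> (\<Union>i\<in>Sigma {..k} K. {G. F i \<subseteq> G})"
    proof
      fix G :: "nat set set" assume "G \<in> {G. k \<le> num_triangles {..<n} G}"
      then have k: "k \<le> num_triangles {..<n} G" by simp
      define T where "T = {t. t \<subseteq> {..<n} \<and> card t = 3 \<and> pairs t \<subseteq> G}"
      have T: "T \<subseteq> Tr" "edges T \<subseteq> G" by (auto simp: T_def Tr_def edges_def)
      have "k \<le> card T" using k by (simp add: T_def num_triangles_def)
      from triangle_decomposition[OF trJ[OF T(1)] this] obtain J where J: "J \<subseteq> T" "card J \<le> k"
        "pairwise disjnt J" "card J = k \<or> (\<exists>C\<subseteq>T. clustered C \<and> k - card J \<le> card C \<and> \<Union>C \<inter> \<Union>J = {})"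
        by blast
      have "\<exists>H\<in>\<H> (k - card J). edges J \<inter> H = {} \<and> H \<subseteq> G"
      proof (cases "card J = k")
        case True
        then show ?thesis using H0 by auto
      next
        case False
        with J(4) obtain C where C: "C \<subseteq> T" "clustered C" "k - card J \<le> card C" "\<Union>C \<inter> \<Union>J = {}" by blast
        have "\<Union>C \<subseteq> {..<n}" using C(1) T(1) unfolding Tr_def by blast
        then obtain H where H: "H \<in> \<H> (k - card J)" "H \<subseteq> edges C"
          using Hex[OF _ C(2) _ C(3)] False J(2) by auto
        have "edges J \<inter> edges C = {}"
        proof -
          have "e \<subseteq> \<Union>A \<and> e \<noteq> {}" if "e \<in> edges A" for e and A :: "nat set set"
          proof -
            from that obtain t where "t \<in> A" "e \<subseteq> t" "card e = 2" by (auto simp: edges_def pairs_def)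
            then show ?thesis by auto
          qed
          then show ?thesis using C(4) by blast
        qed
        moreover have "edges C \<subseteq> G" using edges_mono[OF C(1)] T(2) by blast
        ultimately show ?thesis using H by blast
      qed
      then obtain H where H: "H \<in> \<H> (k - card J)" "edges J \<inter> H = {}" "H \<subseteq> G" by blast
      have "(card J, J, H) \<in> Sigma {..k} K" using H J T by (auto simp: K_def Js_def)
      moreover have "F (card J, J, H) \<subseteq> G" using H(3) edges_mono[OF J(1)] T(2) by (auto simp: F_def)
      ultimately show "G \<in> (\<Union>i\<in>Sigma {..k} K. {G. F i \<subseteq> G})" by blast
    qed
  qed
  also have "\<dots> = (\<Sum>j\<le>k. \<Sum>JH\<in>K j. p ^ card (F (j, JH)))"
    using fK by (subst sum.Sigma) (auto simp: case_prod_beta')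
  also have "\<dots> \<le> (\<Sum>j\<le>k. ((n * p) ^ 3) ^ j / fact j * (\<Sum>H\<in>\<H> (k - j). p ^ card H))"
  proof (rule sum_mono)
    fix j
    have "(\<Sum>JH\<in>K j. p ^ card (F (j, JH))) = (\<Sum>JH\<in>K j. p ^ (3 * j) * p ^ card (snd JH))"
    proof (rule sum.cong)
      fix JH assume "JH \<in> K j"
      then obtain J H where JH: "JH = (J, H)" "J \<subseteq> Tr" "card J = j" "pairwise disjnt J" "H \<in> \<H> (k - j)" "edges J \<inter> H = {}"
        by (auto simp: K_def Js_def)
      have "finite H" using JH(5) Hsub[of "k - j"] finite_subset[of H "pairs {..<n}"] by auto
      then have "card (edges J \<union> H) = 3 * j + card H"
        using JH finite_edges trJ card_edges_disjoint[OF trJ] by (subst card_Un_disjoint) auto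
      then show "p ^ card (F (j, JH)) = p ^ (3 * j) * p ^ card (snd JH)"
        by (simp add: F_def JH(1) power_add)
    qed simp
    also have "\<dots> \<le> (\<Sum>JH\<in>Js j \<times> \<H> (k - j). p ^ (3 * j) * p ^ card (snd JH))"
      using p(1) Ksub fJs fH by (intro sum_mono2) auto
    also have "\<dots> = (\<Sum>J\<in>Js j. \<Sum>H\<in>\<H> (k - j). p ^ (3 * j) * p ^ card H)"
      by (subst sum.cartesian_product) (auto simp: case_prod_beta')
    also have "\<dots> = real (card (Js j)) * (p ^ (3 * j) * (\<Sum>H\<in>\<H> (k - j). p ^ card H))"
      by (simp add: sum_distrib_left)
    also have "\<dots> \<le> real n ^ (3 * j) / fact j * (p ^ (3 * j) * (\<Sum>H\<in>\<H> (k - j). p ^ card H))"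
      using p(1) by (intro mult_right_mono cardJs mult_nonneg_nonneg sum_nonneg) auto
    also have "\<dots> = ((n * p) ^ 3) ^ j / fact j * (\<Sum>H\<in>\<H> (k - j). p ^ card H)"
      by (simp add: power_mult power_mult_distrib)
    finally show "(\<Sum>JH\<in>K j. p ^ card (F (j, JH)))
      \<le> ((n * p) ^ 3) ^ j / fact j * (\<Sum>H\<in>\<H> (k - j). p ^ card H)" .
  qed
  finally show ?thesis .
qed

text \<open>If \<open>m\<close> clustered triangles have weight at most \<open>exp (- m * r)\<close>, every triangle, isolated or not, can be charged the rate
  \<open>r\<close>: factor \<open>exp (- k * r)\<close> out, and the remaining sum over \<open>j\<close> is part of the exponential series at
  \<open>(n * p) ^ 3 * exp r\<close>.\<close>

lemma prob_triangles_le_exp: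
  fixes p r :: real and \<H> :: "nat \<Rightarrow> nat set set set"
  assumes p: "0 \<le> p" "p \<le> 1"
    and Hsub: "\<And>m. \<H> m \<subseteq> Pow (pairs {..<n})"
    and Hex: "\<And>m C. 0 < m \<Longrightarrow> m \<le> k \<Longrightarrow> clustered C \<Longrightarrow> \<Union>C \<subseteq> {..<n} \<Longrightarrow> m \<le> card C \<Longrightarrow> \<exists>H\<in>\<H> m. H \<subseteq> edges C"
    and w: "\<And>m. 0 < m \<Longrightarrow> m \<le> k \<Longrightarrow> (\<Sum>H\<in>\<H> m. p ^ card H) \<le> exp (- real m * r)"
  shows "prob_triangles_ge n p k \<le> exp (- real k * r + (n * p) ^ 3 * exp r)"
proof -
  \<comment> \<open>The empty graph has weight \<open>1\<close>, as it should for \<open>m = 0\<close>; sizes above \<open>k\<close> do not enter the sum.\<close>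
  define K where "K m = (if m = 0 then {{}} else if m \<le> k then \<H> m else Pow (pairs {..<n}))" for m
  have "prob_triangles_ge n p k
    \<le> (\<Sum>j\<le>k. ((n * p) ^ 3) ^ j / fact j * (\<Sum>H\<in>K (k - j). p ^ card H))"
  proof (rule prob_triangles_le_cluster_sum[OF p])
    show "K m \<subseteq> Pow (pairs {..<n})" for m using Hsub by (auto simp: K_def)
    show "\<exists>H\<in>K m. H \<subseteq> edges C"
      if "0 < m" "clustered C" "\<Union>C \<subseteq> {..<n}" "m \<le> card C" for m C
      using Hex[of m C] that edges_subset_pairs[of C "{..<n}"] by (auto simp: K_def)
  qed (simp add: K_def)
  also have "\<dots> \<le> (\<Sum>j\<le>k. ((n * p) ^ 3) ^ j / fact j * exp (- real (k - j) * r))"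
  proof (intro sum_mono mult_left_mono)
    fix j
    show "(\<Sum>H\<in>K (k - j). p ^ card H) \<le> exp (- real (k - j) * r)"
      using w[of "k - j"] by (cases "j < k") (auto simp: K_def algebra_simps)
  qed (use p in auto)
  also have "\<dots> = exp (- real k * r) * (\<Sum>j\<le>k. ((n * p) ^ 3 * exp r) ^ j / fact j)"
    unfolding sum_distrib_left
  proof (intro sum.cong refl)
    fix j assume "j \<in> {..k}"
    then have "exp (- real (k - j) * r) = exp (- real k * r) * exp r ^ j"
      by (simp add: of_nat_diff exp_of_nat_mult[symmetric] exp_add[symmetric] algebra_simps)
    then show "((n * p) ^ 3) ^ j / fact j * exp (- real (k - j) * r)
        = exp (- real k * r) * (((n * p) ^ 3 * exp r) ^ j / fact j)"
      by (simp add: power_mult_distrib)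
  qed
  also have "\<dots> \<le> exp (- real k * r) * exp ((n * p) ^ 3 * exp r)"
  proof (rule mult_left_mono)
    let ?x = "(n * p) ^ 3 * exp r"
    have "(\<Sum>j\<le>k. ?x ^ j / fact j) \<le> (\<Sum>j. ?x ^ j / fact j)"
      using p summable_exp[of ?x] by (intro sum_le_suminf) (auto simp: divide_inverse mult.commute)
    then show "(\<Sum>j\<le>k. ?x ^ j / fact j) \<le> exp ?x" by (simp add: exp_def divide_inverse mult.commute)
  qed simp
  finally show ?thesis by (simp only: exp_add)
qed

section \<open>The weight of a cluster\<close>

text \<open>The clique on about \<open>(6 * k) powr (1/3)\<close> vertices, which has \<open>k\<close> triangles, has about
  \<open>clique_const * k powr (2/3)\<close> edges.\<close>

definition clique_const :: real where
  "clique_const = (3 / sqrt 2) powr (2/3)"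

lemma clique_const_eq: "clique_const = (9/2) powr (1/3)"
proof -
  have "(3 / sqrt 2) powr (2/3) = ((3 / sqrt 2) powr 2) powr (1/3)" unfolding powr_powr by simp
  also have "(3 / sqrt 2) powr 2 = 9/2" by (simp add: power_divide)
  finally show ?thesis by (simp add: clique_const_def)
qed

lemma clique_const_cubed: "clique_const ^ 3 = 9/2"
  by (simp add: clique_const_eq powr_powr flip: powr_numeral)

lemma clique_const_bounds: "1 < clique_const" "clique_const < 2"
proof -
  show "1 < clique_const"
    by (rule power_less_imp_less_base[of _ 3]) (simp_all add: clique_const_cubed clique_const_eq)
  show "clique_const < 2"
    by (rule power_less_imp_less_base[of _ 3]) (simp_all add: clique_const_cubed)
qed

lemma card_edges_ge:
  assumes "triples T"
  shows "clique_const * card T powr (2/3) \<le> card (edges T)"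
proof (rule power_le_imp_le_base[of _ 2])
  have "(card T powr (2/3)) ^ 3 = real (card T) ^ 2"
    by (cases "card T = 0") (simp_all add: powr_powr flip: powr_numeral)
  then have "(clique_const * card T powr (2/3)) ^ 3 = 9/2 * real (card T) ^ 2"
    by (simp only: power_mult_distrib clique_const_cubed)
  also have "\<dots> \<le> real (card (edges T)) ^ 3" using card_triples_le[OF assms] by simp
  finally show "(clique_const * card T powr (2/3)) ^ Suc 2 \<le> real (card (edges T)) ^ Suc 2"
    by (simp add: numeral_3_eq_3)
qed simp

text \<open>For boundedly many triangles it suffices that a cluster has positive excess, since then it costs a factor \<open>1 / n\<close>.\<close>

lemma cluster_contains_excess_one:
  assumes "clustered C" "\<Union>C \<subseteq> {..<n}" "C \<noteq> {}"
  shows "\<exists>H\<in>excess_graphs n 1. H \<subseteq> edges C"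
proof -
  have tC: "triples C" using assms by (simp add: clustered_def)
  obtain t where t: "t \<in> C" using assms(3) by auto
  then have "pairs t \<subseteq> edges C" "card (pairs t) = 3"
    using card_pairs_triple tC by (auto simp: edges_def triples_def)
  then have "3 \<le> card (edges C)" using finite_edges[OF tC] card_mono by metis
  then obtain S where S: "S \<subseteq> C" "card (\<Union>S) + 1 \<le> card (edges S)" "card (edges S) \<le> card (\<Union>S) + 1 + 2"
      "6 * card (\<Union>S) \<le> 5 * card (edges S)"
    using cluster_dichotomy[OF assms(1), of 1] by auto
  moreover have "edges S \<subseteq> pairs {..<n}" using S(1) assms(2) by (intro edges_subset_pairs) auto
  moreover have "\<Union>(edges S) = \<Union>S" using tC S(1) by (intro Union_edges) (rule triples_subset)
  ultimately show ?thesis using edges_mono[OF S(1)] unfolding excess_graphs_def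
    by (intro bexI[of _ "edges S"]) auto
qed

text \<open>If the dichotomy yields no graph of prescribed excess, there are at most \<open>6 * x\<close> edges.  Deleting the edges that lie in fewer
  than \<open>\<theta> = \<eta> * m / (6 * x)\<close> triangles costs at most \<open>\<eta> * m\<close> triangles, and leaves at most
  \<open>2 * 6 * x / \<theta> = 72 * x\<^sup>2 / (\<eta> * m)\<close> vertices.  For \<open>x\<close> of order \<open>m powr (2/3)\<close> this is of order
  \<open>m powr (1/3)\<close>.\<close>

lemma cluster_contains_excess_or_core:
  fixes \<eta> E :: real
  assumes C: "clustered C" "\<Union>C \<subseteq> {..<n}" "m \<le> card C" "0 < m"
    and "0 < x" "0 < \<eta>" "\<eta> < 1"
    and V: "72 * real x ^ 2 / (\<eta> * m) \<le> V" and E: "E \<le> clique_const * ((1 - \<eta>) * m) powr (2/3)"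
  shows "\<exists>H\<in>excess_graphs n x \<union> core_graphs n V E. H \<subseteq> edges C"
proof -
  have tC: "triples C" using C by (simp add: clustered_def)
  have sub: "edges S \<subseteq> pairs {..<n}" "\<Union>(edges S) = \<Union>S" "edges S \<subseteq> edges C" if "S \<subseteq> C" for S
    using that C(2) triples_subset[OF tC that]
    by (auto intro!: edges_subset_pairs Union_edges edges_mono)
  from cluster_dichotomy[OF C(1) assms(5)] show ?thesis
  proof (elim disjE exE conjE)
    fix S assume "S \<subseteq> C" "card (\<Union>S) + x \<le> card (edges S)" "card (edges S) \<le> card (\<Union>S) + x + 2"
      "6 * card (\<Union>S) \<le> 5 * card (edges S)"
    then show ?thesis using sub[of S] by (intro bexI[of _ "edges S"]) (auto simp: excess_graphs_def)
  next
    assume "card (edges C) < card (\<Union>C) + x" "6 * card (\<Union>C) \<le> 5 * card (edges C)"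
    then have e6: "card (edges C) \<le> 6 * x" by linarith
    define \<theta> where "\<theta> = \<eta> * m / (6 * x)"
    have th: "\<theta> > 0" using assms by (simp add: \<theta>_def)
    obtain S where S: "S \<subseteq> C" "real (card C) - \<theta> * card (edges C) \<le> card S"
      "\<theta> * card (\<Union>S) \<le> 2 * card (edges S)"
      using exists_core[OF tC th] by auto
    have tS: "triples S" using tC S(1) by (rule triples_subset)
    have "card (edges S) \<le> card (edges C)" using S(1) finite_edges[OF tC] by (intro card_mono edges_mono)
    then have "\<theta> * card (\<Union>S) \<le> 12 * x" using S(3) e6 by linarith
    then have "card (\<Union>S) \<le> 12 * real x / \<theta>" using th by (simp add: field_simps)
    also have "\<dots> = 72 * real x ^ 2 / (\<eta> * m)" by (simp add: \<theta>_def power2_eq_square)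
    finally have v: "card (\<Union>S) \<le> V" using V by linarith
    have "\<theta> * card (edges C) \<le> \<theta> * (6 * x)" using e6 th by (intro mult_left_mono) auto
    also have "\<dots> = \<eta> * m" using assms(5) by (simp add: \<theta>_def)
    finally have "(1 - \<eta>) * m \<le> card S" using S(2) C(3) by (simp add: algebra_simps)
    then have "((1 - \<eta>) * m) powr (2/3) \<le> card S powr (2/3)" using assms by (intro powr_mono2) auto
    then have "E \<le> clique_const * card S powr (2/3)"
      using E clique_const_bounds(1) by (smt (verit) mult_left_mono)
    also have "\<dots> \<le> card (edges S)" by (rule card_edges_ge[OF tS])
    finally show ?thesis using sub[OF S(1)] v
      by (intro bexI[of _ "edges S"]) (auto simp: core_graphs_def)
  qed
qed

text \<open>The exponent of \<open>\<nu>\<close> on the left is at most \<open>2/15 * (L + 1) - x = - x/5 + 26/15\<close>.  For \<open>x \<ge> 20\<close> this is at most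
  \<open>- x/10 - 1/4\<close>, and \<open>\<nu> powr (1/4) \<ge> 2\<close> supplies the factor \<open>1/2\<close>.\<close>

lemma excess_weight_le:
  fixes D \<nu> :: real and x L :: nat
  assumes "L = 6 * x + 12" "20 \<le> x" "1 \<le> D" "16 \<le> \<nu>" "D * (real L + 1)\<^sup>2 \<le> \<nu> powr (2/15)"
  shows "(real L + 1)\<^sup>2 * (D * (real L)\<^sup>2) ^ L / \<nu> ^ x \<le> \<nu> powr (- (x / 10)) / 2"
proof -
  have L: "0 \<le> real L" by simp
  have "(real L + 1)\<^sup>2 \<le> D * (real L + 1)\<^sup>2" using assms(3) by (simp add: mult_le_cancel_right1)
  then have 1: "(real L + 1)\<^sup>2 \<le> \<nu> powr (2/15)" using assms(5) by linarith
  have "D * (real L)\<^sup>2 \<le> D * (real L + 1)\<^sup>2" using assms(3) by (intro mult_left_mono power_mono) auto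
  then have "D * (real L)\<^sup>2 \<le> \<nu> powr (2/15)" using assms(5) by linarith
  then have "(D * (real L)\<^sup>2) ^ L \<le> (\<nu> powr (2/15)) ^ L" using assms(3) by (intro power_mono) auto
  also have "\<dots> = \<nu> powr (2/15 * L)" using assms(4) by (simp add: powr_powr flip: powr_realpow)
  finally have 2: "(D * (real L)\<^sup>2) ^ L \<le> \<nu> powr (2/15 * L)" .
  have "(real L + 1)\<^sup>2 * (D * (real L)\<^sup>2) ^ L / \<nu> ^ x \<le> \<nu> powr (2/15) * \<nu> powr (2/15 * L) / \<nu> ^ x"
    using 1 2 assms(3,4) by (intro divide_right_mono mult_mono) auto
  also have "\<dots> = \<nu> powr (2/15 + 2/15 * L - x)"
    using assms(4) by (simp add: powr_add powr_diff powr_realpow)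
  also have "\<dots> \<le> \<nu> powr (- (x / 10) - 1/4)"
  proof (rule powr_mono)
    have "real L = 6 * real x + 12" "20 \<le> real x" using assms(1,2) by simp_all
    then show "2/15 + 2/15 * real L - real x \<le> - (x / 10) - 1/4" by linarith
  qed (use assms in simp)
  also have "\<dots> = \<nu> powr (- (x / 10)) / \<nu> powr (1/4)" by (simp add: powr_diff)
  also have "\<dots> \<le> \<nu> powr (- (x / 10)) / 2"
  proof (rule divide_left_mono)
    have "(2::real) = 16 powr (1/4)" using powr_powr[of 2 4 "1/4"] by simp
    also have "\<dots> \<le> \<nu> powr (1/4)" using assms(4) by (intro powr_mono2) auto
    finally show "2 \<le> \<nu> powr (1/4)" .
  qed (use assms in auto)
  finally show ?thesis .
qed

text \<open>With \<open>z = m powr (1/3)\<close>, the choice of the \<open>V = O(z)\<close> vertices costs \<open>O(z * ln n)\<close> in the exponent, and the shape and the powers of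
  \<open>d\<close> cost \<open>O(z\<^sup>2)\<close>.  The main term is of order \<open>z\<^sup>2 * ln n\<close>, so giving up \<open>\<epsilon> / 2\<close> of its constant pays for both once \<open>z\<close> and \<open>n\<close>
  are large.\<close>

lemma core_weight_le:
  fixes n V :: nat and d D B E \<epsilon> z c :: real
  assumes "0 < d" "d \<le> D" "1 \<le> D" "0 < n" "0 < \<epsilon>" "c < 2" "0 \<le> E" "1 \<le> z" "0 \<le> B"
    and V: "V \<le> B * z" and z: "4 * B / \<epsilon> \<le> z" and E: "E = (c - \<epsilon> / 2) * z\<^sup>2"
    and n: "4 * (1 + B + B\<^sup>2 + 2 * ln D) / \<epsilon> \<le> ln n"
  shows "(real V + 1) * real n ^ V * 2 ^ (V\<^sup>2) * (d / n) powr E \<le> exp (- ((c - \<epsilon>) * z\<^sup>2 * ln n)) / 2"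
proof -
  have z2: "z \<le> z\<^sup>2" "1 \<le> z\<^sup>2" using assms(8) by (auto simp: power2_eq_square mult_le_cancel_right1 intro: order_trans)
  have lnD: "0 \<le> ln D" "ln d \<le> ln D" using assms by auto
  have lnn: "0 \<le> ln n" using assms(4) by simp
  have a: "real V + 1 \<le> exp V" using exp_ge_add_one_self[of V] by (simp add: add.commute)
  have b: "real n ^ V = exp (V * ln n)" using assms(4) by (simp add: exp_of_nat_mult)
  have "(2::real) ^ (V\<^sup>2) \<le> exp 1 ^ (V\<^sup>2)" using exp_ge_add_one_self[of 1] by (intro power_mono) auto
  also have "\<dots> = exp (real V ^ 2)" by (simp flip: exp_of_nat_mult)
  finally have c: "(2::real) ^ (V\<^sup>2) \<le> exp (real V ^ 2)" .
  have "(d / n) powr E = exp (E * (ln d - ln n))" using assms(1,4) by (simp add: powr_def ln_div)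
  also have "\<dots> \<le> exp (E * (ln D - ln n))" using assms(7) lnD by (simp add: mult_left_mono)
  finally have e: "(d / n) powr E \<le> exp (E * (ln D - ln n))" .
  have "(real V + 1) * real n ^ V * 2 ^ (V\<^sup>2) * (d / n) powr E
      \<le> exp V * exp (V * ln n) * exp (real V ^ 2) * exp (E * (ln D - ln n))"
    unfolding b using a c e by (intro mult_mono) auto
  also have "\<dots> = exp (V + V * ln n + real V ^ 2 + E * (ln D - ln n))" by (simp add: exp_add)
  also have "\<dots> \<le> exp (- ((c - \<epsilon>) * z\<^sup>2 * ln n) - 1)"
  proof -
    have V1: "real V \<le> B * z\<^sup>2" using V z2 assms(9) mult_left_mono[OF z2(1), of B] by linarith
    have "real V ^ 2 \<le> (B * z) ^ 2" using V by (intro power_mono) auto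
    then have V2: "real V ^ 2 \<le> B\<^sup>2 * z\<^sup>2" by (simp add: power_mult_distrib)
    have "4 * B \<le> \<epsilon> * z" using z assms(5) by (simp add: field_simps)
    then have "(4 * B) * z \<le> (\<epsilon> * z) * z" using assms(8) by (intro mult_right_mono) auto
    then have "B * z \<le> \<epsilon> / 4 * z\<^sup>2" by (simp add: power2_eq_square)
    then have "real V \<le> \<epsilon> / 4 * z\<^sup>2" using V by linarith
    then have V3: "V * ln n \<le> \<epsilon> / 4 * z\<^sup>2 * ln n" using lnn by (intro mult_right_mono)
    have "E \<le> 2 * z\<^sup>2" unfolding E using assms by (intro mult_right_mono) auto
    then have E1: "E * ln D \<le> 2 * z\<^sup>2 * ln D" using lnD by (intro mult_right_mono)
    have "1 + B + B\<^sup>2 + 2 * ln D \<le> \<epsilon> / 4 * ln n" using n assms(5) by (simp add: field_simps)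
    then have "(1 + B + B\<^sup>2 + 2 * ln D) * z\<^sup>2 \<le> (\<epsilon> / 4 * ln n) * z\<^sup>2" by (intro mult_right_mono) auto
    then have n1: "z\<^sup>2 + B * z\<^sup>2 + B\<^sup>2 * z\<^sup>2 + 2 * z\<^sup>2 * ln D \<le> \<epsilon> / 4 * z\<^sup>2 * ln n"
      by (simp add: algebra_simps)
    have "E * ln n = (c - \<epsilon>) * z\<^sup>2 * ln n + \<epsilon> / 4 * z\<^sup>2 * ln n + \<epsilon> / 4 * z\<^sup>2 * ln n"
      unfolding E by (simp add: field_simps)
    then show ?thesis using V1 V2 V3 E1 n1 z2(2) unfolding right_diff_distrib[of E] by (simp only: exp_le_cancel_iff)
  qed
  also have "\<dots> = exp (- ((c - \<epsilon>) * z\<^sup>2 * ln n)) / exp 1" by (simp add: exp_diff)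
  also have "\<dots> \<le> exp (- ((c - \<epsilon>) * z\<^sup>2 * ln n)) / 2"
    using exp_ge_add_one_self[of 1] by (intro divide_left_mono) auto
  finally show ?thesis .
qed

section \<open>Elementary asymptotics\<close>

lemma eventually_ln_ge: "\<forall>\<^sub>F n in sequentially. c \<le> ln (real n)"
  using filterlim_compose[OF ln_at_top filterlim_real_sequentially] by (auto simp: filterlim_at_top)

lemma eventually_powr_ge:
  assumes "a > 0"
  shows "\<forall>\<^sub>F n in sequentially. c \<le> real n powr a"
proof -
  have "filterlim (\<lambda>n. real n powr a) at_top sequentially" using assms by real_asymp
  then show ?thesis by (auto simp: filterlim_at_top)
qed

lemma powr_neg_mult: "0 < n \<Longrightarrow> real n powr (- c * x) = exp (- (c * (x * ln (real n))))"
  by (simp add: powr_def mult.assoc)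

lemma eventually_real_ge: "\<forall>\<^sub>F n in sequentially. c \<le> real n"
  using filterlim_real_sequentially by (auto simp: filterlim_at_top)

lemma powr_two_thirds_mult:
  fixes k l :: real
  assumes "1 \<le> k"
  shows "k powr (2/3) * l = k * (l / k powr (1/3))"
proof -
  have "k powr (1 - 1/3) = k powr 1 / k powr (1/3)" by (rule powr_diff)
  then show ?thesis using assms by simp
qed

section \<open>The upper tail\<close>

text \<open>The bound that serves both regimes, uniformly in \<open>k\<close> and the rate \<open>r\<close>.  The two upper bounds on \<open>r\<close> say that a triangle
  is not charged more than its share in a set of \<open>k\<close> disjoint triangles, and in a
  clique with \<open>k\<close> triangles.  As \<open>m powr (2/3) \<ge> m / k powr (1/3)\<close> for \<open>m \<le> k\<close>, the second bound ensures that \<open>m\<close> clustered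
  triangles have weight at most \<open>exp (- m * r)\<close>.\<close>

lemma upper_tail:
  fixes d \<epsilon> \<mu> :: real
  assumes d: "0 < d" and \<epsilon>: "0 < \<epsilon>" "\<epsilon> < clique_const" and \<mu>: "0 < \<mu>"
  shows "\<forall>\<^sub>F n in sequentially. \<forall>k r. 0 < k \<longrightarrow> real k \<le> real n powr (1/10 - \<mu>) \<longrightarrow>
    0 \<le> r \<longrightarrow> r \<le> ln (real k) \<longrightarrow> r \<le> (clique_const - \<epsilon>) * ln (real n) / real k powr (1/3) \<longrightarrow>
    prob_triangles_ge n (d / n) k \<le> exp (- real k * r + d ^ 3 * exp r)"
proof -
  define D where "D = max d 1"
  have D: "d \<le> D" "1 \<le> D" by (auto simp: D_def)
  \<comment> \<open>Losing the fraction \<open>\<eta>\<close> of the triangles lowers the number of edges of the core by at most \<open>\<epsilon>/2\<close> in the constant.\<close>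
  define \<eta> where "\<eta> = \<epsilon> / (2 * clique_const)"
  have \<eta>: "0 < \<eta>" "\<eta> < 1" using \<epsilon> clique_const_bounds by (auto simp: \<eta>_def field_simps)
  define B where "B = 72 * 21\<^sup>2 / \<eta> + 1"
  have B: "0 \<le> B" using \<eta> by (simp add: B_def)
  \<comment> \<open>Below \<open>M\<close> triangles, choosing the vertices of the core is not of lower order; there one unit of excess suffices.\<close>
  define M where "M = nat \<lceil>(4 * B / \<epsilon>) ^ 3\<rceil> + 1"
  have M: "(4 * B / \<epsilon>) ^ 3 \<le> M" "0 < M" unfolding M_def by linarith+
  \<comment> \<open>\<open>K / n\<close> bounds the weight of the graphs of excess one to three, for which \<open>L = 6 * 1 + 12 = 18\<close>.\<close>
  define K where "K = (18 + 1)\<^sup>2 * (D * 18\<^sup>2) ^ 18"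
  have K: "0 < K" using D by (simp add: K_def)
  have "\<forall>\<^sub>F n in sequentially. 16 \<le> n" by (rule eventually_ge_at_top)
  moreover have "\<forall>\<^sub>F n in sequentially. d \<le> real n" using eventually_powr_ge[of 1 d] by simp
  moreover have "\<forall>\<^sub>F n in sequentially. 2 * ln K \<le> ln (real n)" by (rule eventually_ln_ge)
  moreover have "\<forall>\<^sub>F n in sequentially. 2 * M * ln ((4 * M) ^ 3) \<le> ln (real n)" by (rule eventually_ln_ge)
  moreover have "\<forall>\<^sub>F n in sequentially. 4 * (1 + B + B\<^sup>2 + 2 * ln D) / \<epsilon> \<le> ln (real n)" by (rule eventually_ln_ge)
  moreover have "\<forall>\<^sub>F n in sequentially. D * 140\<^sup>2 \<le> real n powr (4 * \<mu> / 3)"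
    using \<mu> by (intro eventually_powr_ge) simp
  ultimately show ?thesis
  proof (eventually_elim, intro allI impI)
    fix n k :: nat and r :: real
    assume n: "16 \<le> n" "d \<le> real n" "2 * ln K \<le> ln (real n)"
      "2 * M * ln ((4 * M) ^ 3) \<le> ln (real n)" "4 * (1 + B + B\<^sup>2 + 2 * ln D) / \<epsilon> \<le> ln (real n)"
      "D * 140\<^sup>2 \<le> real n powr (4 * \<mu> / 3)"
      and k: "0 < k" "real k \<le> real n powr (1/10 - \<mu>)"
      and r: "0 \<le> r" "r \<le> ln (real k)" "r \<le> (clique_const - \<epsilon>) * ln (real n) / real k powr (1/3)"
    define z where "z m = real m powr (1/3)" for m :: nat
    define x where "x m = nat \<lceil>20 * (z m)\<^sup>2\<rceil>" for m
    define V where "V m = nat \<lceil>72 * real (x m) ^ 2 / (\<eta> * m)\<rceil>" for m :: nat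
    define E where "E m = (clique_const - \<epsilon> / 2) * (z m)\<^sup>2" for m
    define \<H> where "\<H> m = (if m < M then excess_graphs n 1
      else excess_graphs n (x m) \<union> core_graphs n (V m) (E m))" for m
    have lnn: "0 < ln (real n)" using n(1) by simp
    have z3: "z m ^ 3 = m" if "0 < m" for m using that by (simp add: z_def powr_powr flip: powr_numeral)
    have z2: "real m powr (2/3) = (z m)\<^sup>2" if "0 < m" for m
      using that by (simp add: z_def powr_powr flip: powr_numeral)
    have z1: "1 \<le> z m" if "0 < m" for m using that by (simp add: z_def ge_one_powr_ge_zero)
    have zk: "z m \<le> z k" if "m \<le> k" for m using that by (simp add: z_def powr_mono2)
    have x: "20 * (z m)\<^sup>2 \<le> x m" "real (x m) \<le> 21 * (z m)\<^sup>2" "20 \<le> x m" if "0 < m" for m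
    proof -
      have "1 \<le> (z m)\<^sup>2" using z1[OF that] by (rule one_le_power)
      then show "20 * (z m)\<^sup>2 \<le> x m" "real (x m) \<le> 21 * (z m)\<^sup>2" "20 \<le> x m" unfolding x_def by linarith+
    qed
    have mr: "m * r \<le> (clique_const - \<epsilon>) * (z m)\<^sup>2 * ln n" if "0 < m" "m \<le> k" for m
    proof -
      have "m * r \<le> m * ((clique_const - \<epsilon>) * ln n / z k)"
        using r(3) by (intro mult_left_mono) (auto simp: z_def)
      also have "\<dots> = (clique_const - \<epsilon>) * (z m)\<^sup>2 * ln n * (z m / z k)"
        unfolding z3[OF that(1), symmetric] by (simp add: power2_eq_square power3_eq_cube)
      also have "\<dots> \<le> (clique_const - \<epsilon>) * (z m)\<^sup>2 * ln n * 1"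
        using \<epsilon> lnn zk[OF that(2)] z1[OF k(1)] by (intro mult_left_mono) auto
      finally show ?thesis by simp
    qed
    have "prob_triangles_ge n (d / n) k \<le> exp (- real k * r + (n * (d / n)) ^ 3 * exp r)"
    proof (rule prob_triangles_le_exp)
      show "0 \<le> d / n" "d / n \<le> 1" using d n by auto
      show "\<H> m \<subseteq> Pow (pairs {..<n})" for m
        using excess_graphs_subset core_graphs_subset by (simp add: \<H>_def)
      show "\<exists>H\<in>\<H> m. H \<subseteq> edges C"
        if m: "0 < m" "m \<le> k" and C: "clustered C" "\<Union>C \<subseteq> {..<n}" "m \<le> card C" for m C
      proof (cases "m < M")
        case True
        have "C \<noteq> {}" using m(1) C(3) by auto
        then show ?thesis using cluster_contains_excess_one[OF C(1,2)] True by (simp add: \<H>_def)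
      next
        case False
        have "\<exists>H\<in>excess_graphs n (x m) \<union> core_graphs n (V m) (E m). H \<subseteq> edges C"
        proof (rule cluster_contains_excess_or_core[OF C m(1) _ \<eta>])
          show "0 < x m" using x(3)[OF m(1)] by simp
          show "72 * real (x m) ^ 2 / (\<eta> * m) \<le> V m" unfolding V_def by linarith
          have "E m = clique_const * (1 - \<eta>) * (z m)\<^sup>2"
            using clique_const_bounds by (simp add: E_def \<eta>_def field_simps)
          also have "\<dots> \<le> clique_const * (1 - \<eta>) powr (2/3) * (z m)\<^sup>2"
            using \<eta> clique_const_bounds powr_mono'[of "2/3" 1 "1 - \<eta>"]
            by (intro mult_right_mono mult_left_mono) auto
          also have "\<dots> = clique_const * ((1 - \<eta>) * m) powr (2/3)"
            using \<eta> m(1) by (simp add: powr_mult z2)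
          finally show "E m \<le> clique_const * ((1 - \<eta>) * m) powr (2/3)" .
        qed
        then show ?thesis using False by (simp add: \<H>_def)
      qed
      show "(\<Sum>H\<in>\<H> m. (d / n) ^ card H) \<le> exp (- real m * r)" if m: "0 < m" "m \<le> k" for m
      proof (cases "m < M")
        case True
        have "m * r \<le> ln n / 2"
        \<comment> \<open>The rate is small compared with \<open>ln n\<close> for large \<open>k\<close>, and bounded by \<open>ln k\<close> for small \<open>k\<close>.\<close>
        proof (cases "4 * real M \<le> z k")
          case True
          have "m * r \<le> real M * r" using \<open>m < M\<close> r(1) by (intro mult_right_mono) auto
          also have "\<dots> \<le> real M * ((clique_const - \<epsilon>) * ln n / z k)"
            using r(3) by (intro mult_left_mono) (auto simp: z_def)
          also have "\<dots> \<le> real M * (2 * ln n / (4 * real M))"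
            using clique_const_bounds \<epsilon> lnn True M(2) by (intro mult_left_mono frac_le mult_right_mono) auto
          also have "\<dots> = ln n / 2" using M(2) by simp
          finally show ?thesis .
        next
          case False
          then have "z k ^ 3 \<le> (4 * real M) ^ 3" using z1[OF k(1)] by (intro power_mono) auto
          then have "ln (real k) \<le> ln ((4 * real M) ^ 3)"
            unfolding z3[OF k(1)] using k(1) by (intro ln_mono) auto
          then have "r \<le> ln ((4 * real M) ^ 3)" using r(2) by linarith
          then have "m * r \<le> real M * ln ((4 * real M) ^ 3)"
            using \<open>m < M\<close> r(1) by (intro mult_mono) auto
          also have "\<dots> \<le> ln n / 2" using n(4) by simp
          finally show ?thesis .
        qed
        then have mr2: "m * r \<le> ln n - ln K" using n(3) by linarith
        have "(\<Sum>H\<in>\<H> m. (d / n) ^ card H) \<le> K / real n ^ 1"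
          unfolding \<H>_def K_def using True sum_excess_graphs_le[of d D n 18 1] d D n(1) by simp
        also have "\<dots> = exp (ln K - ln n)" using K n(1) by (simp add: exp_diff)
        also have "\<dots> \<le> exp (- real m * r)" using mr2 by simp
        finally show ?thesis .
      next
        case False
        have f: "finite (excess_graphs n (x m))" "finite (core_graphs n (V m) (E m))"
          by (rule finite_subset[OF excess_graphs_subset] finite_subset[OF core_graphs_subset], simp)+
        have "(\<Sum>H\<in>\<H> m. (d / n) ^ card H) = (\<Sum>H\<in>excess_graphs n (x m) \<union> core_graphs n (V m) (E m). (d / n) ^ card H)"
          using False by (simp add: \<H>_def)
        also have "\<dots> \<le> (\<Sum>H\<in>excess_graphs n (x m). (d / n) ^ card H) + (\<Sum>H\<in>core_graphs n (V m) (E m). (d / n) ^ card H)"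
          using f d by (subst sum.union_inter[symmetric]) (auto intro!: sum_nonneg)
        also have "(\<Sum>H\<in>excess_graphs n (x m). (d / n) ^ card H) \<le> exp (- real m * r) / 2"
        proof -
          \<comment> \<open>This is where \<open>k \<le> n powr (1/10 - \<mu>)\<close> enters: \<open>L\<close> is of order \<open>k powr (2/3)\<close>, so \<open>L\<^sup>2\<close> is below \<open>n powr (2/15)\<close>.\<close>
          define L where "L = 6 * x m + 12"
          have "real L + 1 \<le> 140 * (z m)\<^sup>2"
            using x(2)[OF m(1)] one_le_power[OF z1[OF m(1)], of 2] by (simp add: L_def)
          also have "\<dots> \<le> 140 * (z k)\<^sup>2"
            using zk[OF m(2)] z1[OF m(1)] by (intro mult_left_mono power_mono) auto
          also have "\<dots> \<le> 140 * real n powr ((1/10 - \<mu>) * (2/3))"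
            unfolding z2[OF k(1), symmetric] powr_powr[symmetric]
            using k by (intro mult_left_mono powr_mono2) auto
          finally have "D * (real L + 1)\<^sup>2 \<le> D * (140 * real n powr ((1/10 - \<mu>) * (2/3)))\<^sup>2"
            using D by (intro mult_left_mono power_mono) auto
          also have "\<dots> = (D * 140\<^sup>2) * (real n powr ((1/10 - \<mu>) * (2/3)))\<^sup>2"
            by (simp only: power_mult_distrib mult.assoc)
          also have "(real n powr ((1/10 - \<mu>) * (2/3)))\<^sup>2 = real n powr ((1/10 - \<mu>) * (4/3))"
            unfolding power2_eq_square powr_add[symmetric] by (rule arg_cong) argo

          also have "(D * 140\<^sup>2) * real n powr ((1/10 - \<mu>) * (4/3)) \<le> real n powr (4 * \<mu> / 3) * real n powr ((1/10 - \<mu>) * (4/3))"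
            by (intro mult_right_mono n(6) powr_ge_zero)
          also have "\<dots> = real n powr (2/15)" 
            unfolding powr_add[symmetric] by (rule arg_cong) argo
          finally have L: "D * (real L + 1)\<^sup>2 \<le> real n powr (2/15)" .
          have "(\<Sum>H\<in>excess_graphs n (x m). (d / n) ^ card H)
              \<le> (real L + 1)\<^sup>2 * (D * (real L)\<^sup>2) ^ L / real n ^ x m"
            using d D n(1) by (intro sum_excess_graphs_le) (auto simp: L_def)
          also have "\<dots> \<le> real n powr (- (x m / 10)) / 2"
            using n(1) L x(3)[OF m(1)] D by (intro excess_weight_le) (auto simp: L_def)
          also have "real n powr (- (x m / 10)) = exp (- (x m / 10 * ln n))" using n(1) by (simp add: powr_def)
          also have "\<dots> \<le> exp (- real m * r)"
          proof -
            have "m * r \<le> (clique_const - \<epsilon>) * (z m)\<^sup>2 * ln n" by (rule mr[OF m])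
            also have "\<dots> \<le> 2 * (z m)\<^sup>2 * ln n"
              using lnn clique_const_bounds \<epsilon> by (intro mult_right_mono) auto
            also have "\<dots> \<le> x m / 10 * ln n" using x(1)[OF m(1)] lnn by (intro mult_right_mono) auto
            finally show ?thesis by simp
          qed
          finally show ?thesis by simp
        qed
        also have "(\<Sum>H\<in>core_graphs n (V m) (E m). (d / n) ^ card H) \<le> exp (- real m * r) / 2"
        proof -
          have "(\<Sum>H\<in>core_graphs n (V m) (E m). (d / n) ^ card H)
             \<le> (real (V m) + 1) * real n ^ V m * 2 ^ ((V m)\<^sup>2) * (d / n) powr E m"
            using d n(1,2) by (intro sum_core_graphs_le) auto
          also have "\<dots> \<le> exp (- ((clique_const - \<epsilon>) * (z m)\<^sup>2 * ln n)) / 2"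
          proof (rule core_weight_le[where E = "E m" and B = B and D = D])
            show "0 \<le> E m" using \<epsilon> by (simp add: E_def)
            have "(real (x m))\<^sup>2 \<le> (21 * (z m)\<^sup>2)\<^sup>2" using x(2)[OF m(1)] by (intro power_mono) auto
            then have "72 * real (x m) ^ 2 / (\<eta> * m) \<le> 72 * (21 * (z m)\<^sup>2)\<^sup>2 / (\<eta> * m)"
              using \<eta> by (intro divide_right_mono mult_left_mono) auto
            also have "\<dots> = 72 * 21\<^sup>2 / \<eta> * z m"
              unfolding z3[OF m(1), symmetric] using z1[OF m(1)] by (simp add: power2_eq_square power3_eq_cube)
            finally have "72 * real (x m) ^ 2 / (\<eta> * m) \<le> 72 * 21\<^sup>2 / \<eta> * z m" .
            moreover have "0 \<le> 72 * real (x m) ^ 2 / (\<eta> * m)" using \<eta> by simp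
            ultimately have "V m \<le> 72 * 21\<^sup>2 / \<eta> * z m + 1" unfolding V_def by linarith
            then show "V m \<le> B * z m" using z1[OF m(1)] by (simp add: B_def algebra_simps)
            have "(4 * B / \<epsilon>) ^ 3 \<le> z m ^ 3" using M(1) False by (simp add: z3[OF m(1)])
            then show "4 * B / \<epsilon> \<le> z m" 
              using power_mono_iff[of "4 * B / \<epsilon>" "z m" 3] z1[OF m(1)] B \<epsilon>(1) by simp
            show "0 < n" using n(1) by simp
            show "E m = (clique_const - \<epsilon> / 2) * (z m)\<^sup>2" by (simp add: E_def)
          qed (rule d D \<epsilon>(1) clique_const_bounds(2) z1[OF m(1)] B n(5))+
          also have "\<dots> \<le> exp (- real m * r) / 2" using mr[OF m] by simp
          finally show ?thesis .
        qed
        finally show ?thesis by simp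
      qed
    qed
    then show "prob_triangles_ge n (d / n) k \<le> exp (- real k * r + d ^ 3 * exp r)" using n(1) by simp
  qed
qed

section \<open>Lower bound from disjoint triangles\<close>

text \<open>A transversal triangle takes one vertex from each of the blocks \<open>{..<w}\<close>, \<open>{w..<2 * w}\<close> and \<open>{2 * w..<3 * w}\<close>; it is
  represented by the three offsets inside the blocks.\<close>

abbreviation tripartite_index :: "nat \<Rightarrow> (nat \<times> nat \<times> nat) set" where
  "tripartite_index w \<equiv> {..<w} \<times> {..<w} \<times> {..<w}"

definition tri :: "nat \<Rightarrow> nat \<times> nat \<times> nat \<Rightarrow> nat set" where
  "tri w = (\<lambda>(a, b, c). {a, w + b, 2 * w + c})"

definition matchings :: "nat \<Rightarrow> nat \<Rightarrow> (nat \<times> nat \<times> nat) set set" where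
  "matchings w k = {J. J \<subseteq> tripartite_index w \<and> card J = k \<and>
     (\<forall>q\<in>J. \<forall>q'\<in>J. q \<noteq> q' \<longrightarrow> tri w q \<inter> tri w q' = {})}"

lemma card_tri: "q \<in> tripartite_index w \<Longrightarrow> card (tri w q) = 3"
  by (auto simp: tri_def card_insert_if)

lemma inj_on_tri: "inj_on (tri w) (tripartite_index w)"
proof (rule inj_onI)
  fix q q' assume q: "q \<in> tripartite_index w" "q' \<in> tripartite_index w" and eq: "tri w q = tri w q'"
  obtain a b c a' b' c' where abc: "q = (a, b, c)" "q' = (a', b', c')" by (cases q, cases q') auto
  have "a \<in> tri w q'" "w + b \<in> tri w q'" "2 * w + c \<in> tri w q'"
    using eq[symmetric] by (auto simp: tri_def abc)
  then show "q = q'" using q by (auto simp: abc tri_def)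
qed

lemma tri_subset: "q \<in> tripartite_index w \<Longrightarrow> 3 * w \<le> n \<Longrightarrow> tri w q \<subseteq> {..<n}"
  by (auto simp: tri_def)

lemma shared_edge_coordinates:
  assumes "(a, b, c) \<in> tripartite_index w" "(a', b', c') \<in> tripartite_index w"
    and "e \<in> pairs (tri w (a, b, c))" "e \<in> pairs (tri w (a', b', c'))"
  shows "a = a' \<and> b = b' \<or> a = a' \<and> c = c' \<or> b = b' \<and> c = c'"
proof -
  from assms(3) obtain x y where e: "e = {x, y}" "x \<noteq> y" by (auto simp: pairs_def card_2_iff)
  with assms(3,4) have "x \<in> tri w (a, b, c)" "y \<in> tri w (a, b, c)" "x \<in> tri w (a', b', c')" "y \<in> tri w (a', b', c')"
    by (auto simp: pairs_def)
  moreover have "v = a \<and> a = a' \<or> v = w + b \<and> b = b' \<or> v = 2 * w + c \<and> c = c'"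
    if "v \<in> tri w (a, b, c)" "v \<in> tri w (a', b', c')" for v
  proof -
    have "v = a \<or> v = w + b \<or> v = 2 * w + c" "v = a' \<or> v = w + b' \<or> v = 2 * w + c'"
      using that by (auto simp: tri_def)
    moreover have "a < w" "b < w" "c < w" "a' < w" "b' < w" "c' < w" using assms(1,2) by auto
    ultimately show ?thesis by linarith
  qed
  ultimately show ?thesis using e(2) by metis
qed

text \<open>A set \<open>S\<close> of \<open>k\<close> vertices of the first block and injections of \<open>S\<close> into the other two blocks determine a matching.
  Choosing the first vertices as a set, not as a sequence, makes this map injective and gives the factor \<open>1 / k!\<close> that the bound
  needs.\<close>

lemma card_matchings_ge:
  assumes "k \<le> w"
  shows "(w choose k) * ((w - k) ^ k)\<^sup>2 \<le> card (matchings w k)"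
proof -
  define Ss where "Ss = {S. S \<subseteq> {..<w} \<and> card S = k}"
  define F where "F S = {f \<in> S \<rightarrow>\<^sub>E {..<w}. inj_on f S}" for S :: "nat set"
  define \<Phi> where "\<Phi> = (\<lambda>(S, f, g). (\<lambda>a. (a, f a, g a)) ` S :: (nat \<times> nat \<times> nat) set)"
  have fS: "finite S" if "S \<in> Ss" for S using that finite_subset[of S "{..<w}"] by (auto simp: Ss_def)
  have cF: "(w - k) ^ k \<le> card (F S)" if "S \<in> Ss" for S
  proof -
    have "card (F S) = prod ((-) w) {0..<k}"
      unfolding F_def using card_inj_on_subset_funcset[OF fS[OF that] _ order_refl, of "{..<w}"] that
      by (simp add: Ss_def)
    moreover have "(\<Prod>i\<in>{0..<k}. w - k) \<le> prod ((-) w) {0..<k}" by (intro prod_mono) auto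
    ultimately show ?thesis by simp
  qed
  have finF: "finite (F S)" if "S \<in> Ss" for S
    unfolding F_def using finite_PiE[OF fS[OF that], of "\<lambda>_. {..<w}"] by auto
  have inj: "inj_on \<Phi> (Sigma Ss (\<lambda>S. F S \<times> F S))"
  proof (rule inj_onI)
    fix u v assume u: "u \<in> Sigma Ss (\<lambda>S. F S \<times> F S)" and v: "v \<in> Sigma Ss (\<lambda>S. F S \<times> F S)" and eq: "\<Phi> u = \<Phi> v"
    obtain S f g T f' g' where uv: "u = (S, f, g)" "v = (T, f', g')" by (cases u, cases v) auto
    have "fst ` \<Phi> u = S" "fst ` \<Phi> v = T" by (auto simp: \<Phi>_def uv image_image)
    with eq have ST: "S = T" by simp
    have "f a = f' a \<and> g a = g' a" if "a \<in> S" for a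
    proof -
      have "(a, f a, g a) \<in> \<Phi> v" using that by (simp add: eq[symmetric]) (auto simp: \<Phi>_def uv)
      then show ?thesis by (auto simp: \<Phi>_def uv)
    qed
    moreover have "f \<in> S \<rightarrow>\<^sub>E {..<w}" "g \<in> S \<rightarrow>\<^sub>E {..<w}" "f' \<in> S \<rightarrow>\<^sub>E {..<w}" "g' \<in> S \<rightarrow>\<^sub>E {..<w}"
      using u v by (auto simp: uv F_def ST)
    ultimately have "f = f'" "g = g'" by (auto intro: PiE_ext)
    then show "u = v" by (simp add: uv ST)
  qed
  have img: "\<Phi> ` Sigma Ss (\<lambda>S. F S \<times> F S) \<subseteq> matchings w k"
  proof
    fix J assume "J \<in> \<Phi> ` Sigma Ss (\<lambda>S. F S \<times> F S)"
    then obtain S f g where S: "S \<in> Ss" "f \<in> F S" "g \<in> F S" and J: "J = (\<lambda>a. (a, f a, g a)) ` S"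
      by (auto simp: \<Phi>_def)
    have lt: "a < w" "f a < w" "g a < w" if "a \<in> S" for a
      using S that by (auto simp: Ss_def F_def)
    have "J \<subseteq> tripartite_index w" using lt by (auto simp: J)
    moreover have "card J = k" unfolding J using S(1) by (subst card_image) (auto simp: inj_on_def Ss_def)
    moreover have "tri w q \<inter> tri w q' = {}" if qq: "q \<in> J" "q' \<in> J" "q \<noteq> q'" for q q'
    proof -
      obtain a a' where a: "a \<in> S" "a' \<in> S" "q = (a, f a, g a)" "q' = (a', f a', g a')"
        using qq by (auto simp: J)
      with qq(3) have "a \<noteq> a'" by auto
      then have "f a \<noteq> f a'" "g a \<noteq> g a'" using S a by (auto simp: F_def inj_on_def)
      then show ?thesis using \<open>a \<noteq> a'\<close> lt[OF a(1)] lt[OF a(2)] by (auto simp: tri_def a)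
    qed
    ultimately show "J \<in> matchings w k" by (auto simp: matchings_def)
  qed
  have fm: "finite (matchings w k)"
    by (rule finite_subset[of _ "Pow (tripartite_index w)"]) (auto simp: matchings_def)
  have "(w choose k) * ((w - k) ^ k)\<^sup>2 = (\<Sum>S\<in>Ss. ((w - k) ^ k)\<^sup>2)"
    using n_subsets[of "{..<w}" k] by (simp add: Ss_def)
  also have "\<dots> \<le> (\<Sum>S\<in>Ss. card (F S \<times> F S))"
    by (intro sum_mono) (simp add: card_cartesian_product power2_eq_square mult_mono cF)
  also have "\<dots> = card (Sigma Ss (\<lambda>S. F S \<times> F S))"
    using finF by (subst card_SigmaI) (auto simp: Ss_def)
  also have "\<dots> \<le> card (matchings w k)" by (rule card_inj_on_le[OF inj img fm])
  finally show ?thesis .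
qed

text \<open>The edges of \<open>J\<close> are present with probability \<open>p ^ (3 * k)\<close>; from this, subtract the probability that a further transversal
  triangle \<open>q\<close> is present as well.  There are \<open>w ^ 3\<close> choices of \<open>q\<close>, and mostly \<open>q\<close> needs three new edges.  Sharing an edge with
  \<open>J\<close> means that two of the three coordinates agree, which leaves \<open>3 * k * w\<close> choices, and then \<open>q\<close> still needs two new
  edges: two shared edges would have a common vertex, hence belong to the same member of \<open>J\<close>, which would be \<open>q\<close> itself.\<close>

lemma prob_exact_matching_ge:
  fixes p :: real
  assumes p: "0 \<le> p" "p \<le> 1" and w: "3 * w \<le> n" and J: "J \<in> matchings w k"
  shows "p ^ (3 * k) * (1 - (w * p) ^ 3 - 3 * real k * real w * p\<^sup>2)
    \<le> measure_pmf.prob (gnp n p) {G. {q \<in> tripartite_index w. pairs (tri w q) \<subseteq> G} = J}"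
proof -
  let ?Q = "tripartite_index w" and ?P = "measure_pmf.prob (gnp n p)"
  define EJ where "EJ = edges (tri w ` J)"
  have JQ: "J \<subseteq> ?Q" "card J = k" and Jd: "\<And>q q'. q \<in> J \<Longrightarrow> q' \<in> J \<Longrightarrow> q \<noteq> q' \<Longrightarrow> tri w q \<inter> tri w q' = {}"
    using J by (auto simp: matchings_def)
  have fJ: "finite J" using JQ finite_subset by (metis finite_SigmaI finite_lessThan)
  have tJ: "triples (tri w ` J)" using JQ fJ card_tri by (auto simp: triples_def)
  have dJ: "pairwise disjnt (tri w ` J)" 
  proof (rule pairwise_imageI)
    fix q q' assume "q \<in> J" "q' \<in> J" "q \<noteq> q'"
    then show "disjnt (tri w q) (tri w q')" unfolding disjnt_def by (rule Jd)
  qed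
  have cJ: "card (tri w ` J) = k" using JQ inj_on_subset[OF inj_on_tri JQ(1)] by (simp add: card_image)
  have cEJ: "card EJ = 3 * k" unfolding EJ_def card_edges_disjoint[OF tJ dJ] cJ ..
  have fEJ: "finite EJ" unfolding EJ_def by (rule finite_edges[OF tJ])
  have EJsub: "EJ \<subseteq> pairs {..<n}"
    unfolding EJ_def using tri_subset[OF _ w] JQ by (intro edges_subset_pairs) blast
  have qsub: "pairs (tri w q) \<subseteq> pairs {..<n}" if "q \<in> ?Q" for q
    using tri_subset[OF that w] by (rule pairs_mono)
  define B where "B = {q \<in> ?Q. pairs (tri w q) \<inter> EJ \<noteq> {}}"
  have "card B \<le> card (\<Union>(a, b, c)\<in>J. (\<lambda>x. (a, b, x)) ` {..<w} \<union> (\<lambda>x. (a, x, c)) ` {..<w} \<union> (\<lambda>x. (x, b, c)) ` {..<w})"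
  proof (rule card_mono)
    show "B \<subseteq> (\<Union>(a, b, c)\<in>J. (\<lambda>x. (a, b, x)) ` {..<w} \<union> (\<lambda>x. (a, x, c)) ` {..<w} \<union> (\<lambda>x. (x, b, c)) ` {..<w})"
    proof
      fix q assume "q \<in> B"
      then obtain e j where e: "q \<in> ?Q" "e \<in> pairs (tri w q)" "j \<in> J" "e \<in> pairs (tri w j)"
        by (auto simp: B_def EJ_def edges_def)
      obtain a b c a' b' c' where abc: "q = (a, b, c)" "j = (a', b', c')" by (cases q, cases j) auto
      have j: "j \<in> ?Q" using e(3) JQ by auto
      have "a = a' \<and> b = b' \<or> a = a' \<and> c = c' \<or> b = b' \<and> c = c'"
        using shared_edge_coordinates[of a b c w a' b' c' e] e j by (simp add: abc)
      then have "q \<in> (\<lambda>x. (a', b', x)) ` {..<w} \<union> (\<lambda>x. (a', x, c')) ` {..<w} \<union> (\<lambda>x. (x, b', c')) ` {..<w}"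
        using e(1) by (auto simp: abc)
      then show "q \<in> (\<Union>(a, b, c)\<in>J. (\<lambda>x. (a, b, x)) ` {..<w} \<union> (\<lambda>x. (a, x, c)) ` {..<w} \<union> (\<lambda>x. (x, b, c)) ` {..<w})"
        using e(3) by (intro UN_I[of j]) (simp_all add: abc)
    qed
  qed (use fJ in auto)
  also have "\<dots> \<le> (\<Sum>(a, b, c)\<in>J. card ((\<lambda>x. (a, b, x)) ` {..<w} \<union> (\<lambda>x. (a, x, c)) ` {..<w} \<union> (\<lambda>x. (x, b, c)) ` {..<w}))"
    using card_UN_le[OF fJ] by (simp add: case_prod_beta')
  also have "\<dots> \<le> (\<Sum>j\<in>J. 3 * w)"
  proof (rule sum_mono, clarify)
    fix a b c :: nat
    let ?A = "(\<lambda>x. (a, b, x)) ` {..<w}" and ?B = "(\<lambda>x. (a, x, c)) ` {..<w}" and ?C = "(\<lambda>x. (x, b, c)) ` {..<w}"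
    have "card ?A \<le> w" "card ?B \<le> w" "card ?C \<le> w" 
      using card_image_le[of "{..<w}" "\<lambda>x. (a, b, x)"] card_image_le[of "{..<w}" "\<lambda>x. (a, x, c)"]
        card_image_le[of "{..<w}" "\<lambda>x. (x, b, c)"] by simp_all
    then show "card (?A \<union> ?B \<union> ?C) \<le> 3 * w" using card_Un_le[of "?A \<union> ?B" ?C] card_Un_le[of ?A ?B] by linarith
  qed
  finally have cB: "card B \<le> 3 * k * w" using JQ by simp
  have weight: "p ^ card (EJ \<union> pairs (tri w q)) \<le> p ^ (3 * k) * (p ^ 3 + (if q \<in> B then p\<^sup>2 else 0))"
    if q: "q \<in> ?Q - J" for q
  proof -
    have ct: "card (tri w q) = 3" "finite (tri w q)" using q card_tri by (auto intro: card_ge_0_finite)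
    have "card (EJ \<union> pairs (tri w q)) = 3 * k + card (pairs (tri w q) - EJ)"
      using card_Un_disjoint[of EJ "pairs (tri w q) - EJ"] fEJ ct(2) cEJ by simp
    then have split: "p ^ card (EJ \<union> pairs (tri w q)) = p ^ (3 * k) * p ^ card (pairs (tri w q) - EJ)"
      by (simp add: power_add)
    have c3: "card (pairs (tri w q)) = 3" by (rule card_pairs_triple[OF ct(1)])
    have "p ^ card (pairs (tri w q) - EJ) \<le> p ^ 3 + (if q \<in> B then p\<^sup>2 else 0)"
    proof (cases "q \<in> B")
      case False
      then have "pairs (tri w q) - EJ = pairs (tri w q)" using q by (auto simp: B_def)
      then show ?thesis using False c3 by simp
    next
      case True
      have "card (pairs (tri w q) \<inter> EJ) \<le> 1"
      proof (rule ccontr)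
        assume "\<not> card (pairs (tri w q) \<inter> EJ) \<le> 1"
        then obtain e f where ef: "e \<in> pairs (tri w q)" "f \<in> pairs (tri w q)" "e \<in> EJ" "f \<in> EJ" "e \<noteq> f"
          by (metis (no_types, lifting) IntE One_nat_def card_le_Suc0_iff_eq ct(2) finite_Int finite_pairs)
        then have ec: "card e = 2" "card f = 2" "e \<subseteq> tri w q" "f \<subseteq> tri w q" by (auto simp: pairs_def)
        have fin: "finite e" "finite f" using ec ct finite_subset by blast+
        have un: "card (e \<union> f) \<le> 3" using card_mono[of "tri w q" "e \<union> f"] ec ct by simp
        have "card (e \<inter> f) < 2"
        proof -
          have "e \<inter> f \<subset> e" using ef(5) ec fin card_subset_eq[of f e] by auto
          then show ?thesis using ec(1) fin psubset_card_mono by metis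
        qed
        moreover have "card e + card f = card (e \<union> f) + card (e \<inter> f)" by (rule card_Un_Int[OF fin])
        ultimately have "card (e \<inter> f) = 1" "card (e \<union> f) = 3" using un ec by linarith+
        then have ne: "e \<inter> f \<noteq> {}" and tq: "e \<union> f = tri w q"
          using card_subset_eq[of "tri w q" "e \<union> f"] ec ct by auto
        obtain i j where ij: "i \<in> J" "j \<in> J" "e \<subseteq> tri w i" "f \<subseteq> tri w j"
          using ef(3,4) by (auto simp: EJ_def edges_def pairs_def)
        then have "i = j" using Jd[of i j] ne by blast
        then have "tri w q \<subseteq> tri w i" using ij tq by auto
        moreover have "card (tri w i) = 3" using ij JQ card_tri by blast
        ultimately have "tri w q = tri w i" using ct card_subset_eq[of "tri w i" "tri w q"]
          by (metis card.infinite zero_neq_numeral)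
        then have "q = i" using inj_onD[OF inj_on_tri] q ij JQ by blast
        then show False using ij q by simp
      qed
      then have "2 \<le> card (pairs (tri w q) - EJ)"
        using c3 card_Diff_subset_Int[of "pairs (tri w q)" EJ] ct by simp
      then have "p ^ card (pairs (tri w q) - EJ) \<le> p\<^sup>2" using p by (intro power_decreasing) auto
      then show ?thesis using True p by (simp add: add_increasing)
    qed
    then show ?thesis unfolding split using p by (intro mult_left_mono) auto
  qed
  have "?P {G. EJ \<subseteq> G} \<le> ?P ({G. {q \<in> ?Q. pairs (tri w q) \<subseteq> G} = J} \<union> (\<Union>q\<in>?Q - J. {G. EJ \<union> pairs (tri w q) \<subseteq> G}))"
    by (intro measure_pmf.finite_measure_mono) (use JQ in \<open>auto simp: EJ_def edges_def\<close>)
  also have "\<dots> \<le> ?P {G. {q \<in> ?Q. pairs (tri w q) \<subseteq> G} = J} + ?P (\<Union>q\<in>?Q - J. {G. EJ \<union> pairs (tri w q) \<subseteq> G})"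
    by (intro measure_Un_le) auto
  finally have main: "p ^ (3 * k) \<le> ?P {G. {q \<in> ?Q. pairs (tri w q) \<subseteq> G} = J}
      + ?P (\<Union>q\<in>?Q - J. {G. EJ \<union> pairs (tri w q) \<subseteq> G})"
    using prob_gnp_superset[OF p EJsub] cEJ by simp
  have "?P (\<Union>q\<in>?Q - J. {G. EJ \<union> pairs (tri w q) \<subseteq> G}) \<le> (\<Sum>q\<in>?Q - J. p ^ card (EJ \<union> pairs (tri w q)))"
    by (rule prob_gnp_union_bound[OF p]) (use EJsub qsub in auto)
  also have "\<dots> \<le> (\<Sum>q\<in>?Q - J. p ^ (3 * k) * (p ^ 3 + (if q \<in> B then p\<^sup>2 else 0)))"
    by (intro sum_mono weight)
  also have "\<dots> \<le> (\<Sum>q\<in>?Q. p ^ (3 * k) * (p ^ 3 + (if q \<in> B then p\<^sup>2 else 0)))"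
    using p by (intro sum_mono2) auto
  also have "\<dots> = p ^ (3 * k) * (real (card ?Q) * p ^ 3 + real (card B) * p\<^sup>2)"
  proof -
    have "(\<Sum>q\<in>?Q. if q \<in> B then p\<^sup>2 else 0) = real (card B) * p\<^sup>2"
      by (subst sum.inter_restrict[symmetric]) (auto simp: B_def Int_def)
    then show ?thesis by (simp add: sum_distrib_left[symmetric] sum.distrib)
  qed
  also have "\<dots> \<le> p ^ (3 * k) * ((w * p) ^ 3 + 3 * real k * real w * p\<^sup>2)"
  proof (intro mult_left_mono add_mono)
    show "real (card ?Q) * p ^ 3 \<le> (w * p) ^ 3"
      by (simp add: card_cartesian_product power_mult_distrib power3_eq_cube)
    show "real (card B) * p\<^sup>2 \<le> 3 * real k * real w * p\<^sup>2"
      using of_nat_mono[OF cB, where ?'a = real] by (intro mult_right_mono) auto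
  qed (use p in auto)
  finally show ?thesis using main by (simp add: algebra_simps)
qed

text \<open>Prescribing the transversal triangles exactly makes the events for different matchings disjoint, so their probabilities add
  up without loss.\<close>

lemma prob_triangles_ge_matchings:
  fixes p :: real
  assumes p: "0 \<le> p" "p \<le> 1" and w: "3 * w \<le> n"
  shows "card (matchings w k) * (p ^ (3 * k) * (1 - (w * p) ^ 3 - 3 * real k * real w * p\<^sup>2)) \<le> prob_triangles_ge n p k"
proof -
  let ?Q = "tripartite_index w" and ?P = "measure_pmf.prob (gnp n p)"
  let ?Ev = "\<lambda>J. {G. {q \<in> ?Q. pairs (tri w q) \<subseteq> G} = J}"
  have fm: "finite (matchings w k)"
    by (rule finite_subset[of _ "Pow ?Q"]) (auto simp: matchings_def)
  have "card (matchings w k) * (p ^ (3 * k) * (1 - (w * p) ^ 3 - 3 * real k * real w * p\<^sup>2))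
      = (\<Sum>J\<in>matchings w k. p ^ (3 * k) * (1 - (w * p) ^ 3 - 3 * real k * real w * p\<^sup>2))" by simp
  also have "\<dots> \<le> (\<Sum>J\<in>matchings w k. ?P (?Ev J))"
    by (intro sum_mono prob_exact_matching_ge[OF p w])
  also have "\<dots> = ?P (\<Union>J\<in>matchings w k. ?Ev J)"
    using fm by (intro measure_pmf.finite_measure_finite_Union[symmetric]) (auto simp: disjoint_family_on_def)
  also have "\<dots> \<le> prob_triangles_ge n p k"
    unfolding prob_triangles_ge_def
  proof (rule measure_pmf.finite_measure_mono)
    show "(\<Union>J\<in>matchings w k. ?Ev J) \<subseteq> {G. k \<le> num_triangles {..<n} G}"
    proof clarify
      fix G :: "nat set set" assume m: "{q \<in> ?Q. pairs (tri w q) \<subseteq> G} \<in> matchings w k"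
      let ?J = "{q \<in> ?Q. pairs (tri w q) \<subseteq> G}"
      have "k = card (tri w ` ?J)"
        using m inj_on_subset[OF inj_on_tri, of ?J w] by (subst card_image) (auto simp: matchings_def)
      also have "\<dots> \<le> num_triangles {..<n} G"
        unfolding num_triangles_def
      proof (rule card_mono)
        show "finite {T. T \<subseteq> {..<n} \<and> card T = 3 \<and> pairs T \<subseteq> G}"
          by (rule finite_subset[of _ "Pow {..<n}"]) auto
        show "tri w ` ?J \<subseteq> {T. T \<subseteq> {..<n} \<and> card T = 3 \<and> pairs T \<subseteq> G}"
          using card_tri tri_subset[OF _ w] by blast
      qed
      finally show "k \<le> num_triangles {..<n} G" .
    qed
  qed simp
  finally show ?thesis .
qed

lemma lower_tail_disjoint:
  fixes d :: real
  assumes d: "0 < d"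
  shows "\<exists>c>0. \<forall>\<^sub>F n in sequentially. \<forall>k. 0 < k \<longrightarrow> real k \<le> sqrt (real n) \<longrightarrow>
    exp (- real k * ln (real k) - c * real k) \<le> prob_triangles_ge n (d / n) k"
proof -
  \<comment> \<open>Blocks of size \<open>\<eta> * n\<close> fit into the vertex set, and the expected number of transversal triangles, at most \<open>(\<eta> * d) ^ 3\<close>, is small.\<close>
  define \<eta> where "\<eta> = 1 / (3 * max d 1)"
  have \<eta>: "0 < \<eta>" "3 * \<eta> \<le> 1" "3 * (\<eta> * d) \<le> 1" by (auto simp: \<eta>_def field_simps)
  define c where "c = max 1 (ln (8 / (\<eta> * d / 2) ^ 3))"
  have ev: "\<forall>\<^sub>F n in sequentially. 2 / \<eta> \<le> real n \<and> 4 / \<eta> \<le> real n powr (1/2) \<and> d \<le> real n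
    \<and> 4 * d \<le> real n powr (1/2) \<and> 0 < n"
    by (intro eventually_conj eventually_real_ge eventually_powr_ge eventually_gt_at_top) auto
  have "\<forall>\<^sub>F n in sequentially. \<forall>k. 0 < k \<longrightarrow> real k \<le> sqrt (real n) \<longrightarrow>
    exp (- real k * ln (real k) - c * real k) \<le> prob_triangles_ge n (d / n) k"
    using ev
  proof (eventually_elim, intro allI impI)
    fix n k :: nat
    assume "2 / \<eta> \<le> real n \<and> 4 / \<eta> \<le> real n powr (1/2) \<and> d \<le> real n \<and> 4 * d \<le> real n powr (1/2) \<and> 0 < n"
      and k: "0 < k" "real k \<le> sqrt (real n)"
    then have n: "2 \<le> \<eta> * n" "4 \<le> \<eta> * sqrt n" "d \<le> real n" "4 * d \<le> sqrt n" "0 < n"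
      using \<eta>(1) by (auto simp: field_simps powr_half_sqrt)
    have sq: "sqrt n * sqrt n = n" by simp
    define w where "w = nat \<lfloor>\<eta> * n\<rfloor>"
    have wge: "\<eta> * n - 1 \<le> w" and wle: "w \<le> \<eta> * n" using n(1) unfolding w_def by linarith+
    have w2: "\<eta> * n / 2 \<le> w" using wge n(1) by linarith
    have "4 * sqrt n \<le> \<eta> * sqrt n * sqrt n" using n(2) by (intro mult_right_mono) auto
    then have "4 * sqrt n \<le> \<eta> * n" using sq by (simp add: mult.assoc)
    then have kw: "2 * real k \<le> w" using k(2) w2 by linarith
    have w3: "3 * w \<le> n"
    proof -
      have "3 * real w \<le> (3 * \<eta>) * n" using wle by simp
      also have "\<dots> \<le> 1 * real n" using \<eta>(2) by (intro mult_right_mono) auto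
      finally show ?thesis by linarith
    qed
    define p where "p = d / n"
    have p: "0 < p" "p \<le> 1" using d n by (auto simp: p_def)
    have wp_le: "w * p \<le> 1/3"
    proof -
      have "w * p \<le> \<eta> * n * p" using wle p by (intro mult_right_mono) auto
      also have "\<dots> = \<eta> * d" using n(5) by (simp add: p_def)
      finally show ?thesis using \<eta>(3) by linarith
    qed
    have wp_ge: "\<eta> * d / 2 \<le> w * p"
    proof -
      have "\<eta> * d / 2 = \<eta> * n / 2 * p" using n(5) by (simp add: p_def)
      also have "\<dots> \<le> w * p" using w2 p by (intro mult_right_mono) auto
      finally show ?thesis .
    qed
    have kp: "k * p \<le> 1/4"
    proof -
      have "4 * (k * d) \<le> sqrt n * (4 * d)" using k(2) d by simp
      also have "\<dots> \<le> sqrt n * sqrt n" using n(4) by (intro mult_left_mono) auto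
      finally show ?thesis using n(5) by (simp add: p_def field_simps)
    qed
    have half: "1/2 \<le> 1 - (w * p) ^ 3 - 3 * real k * real w * p\<^sup>2"
    proof -
      have "(w * p) ^ 3 \<le> (1/3) ^ 3" using wp_le p by (intro power_mono) auto
      moreover have "(k * p) * (w * p) \<le> 1/4 * (1/3)" using kp wp_le p by (intro mult_mono) auto
      ultimately show ?thesis by (simp add: power2_eq_square power3_eq_cube algebra_simps)
    qed
    have "(w ^ 3 / (4 * k)) ^ k \<le> card (matchings w k)"
    proof -
      have "(w ^ 3 / (4 * k)) ^ k = (w / k) ^ k * ((w / 2) ^ k)\<^sup>2"
        by (simp add: power_mult_distrib[symmetric] power2_eq_square power3_eq_cube ac_simps)
      also have "\<dots> \<le> real (w choose k) * ((real (w - k)) ^ k)\<^sup>2"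
        using kw by (intro mult_mono power_mono binomial_ge_n_over_k_pow_k) (auto simp: of_nat_diff)
      also have "\<dots> = real ((w choose k) * ((w - k) ^ k)\<^sup>2)" by simp
      also have "\<dots> \<le> card (matchings w k)"
        using card_matchings_ge[of k w] kw by (intro of_nat_mono) auto
      finally show ?thesis .
    qed
    then have "(w ^ 3 / (4 * k)) ^ k * (p ^ (3 * k) * (1/2))
        \<le> card (matchings w k) * (p ^ (3 * k) * (1 - (w * p) ^ 3 - 3 * real k * real w * p\<^sup>2))"
      using half p by (intro mult_mono mult_left_mono) auto
    also have "\<dots> \<le> prob_triangles_ge n p k" using p w3 by (intro prob_triangles_ge_matchings) auto
    finally have 1: "(w ^ 3 / (4 * k)) ^ k * (p ^ (3 * k) * (1/2)) \<le> prob_triangles_ge n p k" .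
    have "exp (- real k * ln (real k) - c * real k) = exp (- ln (real k) - c) ^ k"
      by (simp add: exp_of_nat_mult[symmetric] algebra_simps)
    also have "\<dots> \<le> ((\<eta> * d / 2) ^ 3 / (8 * k)) ^ k"
    proof (rule power_mono)
      have "exp (- ln (real k) - c) \<le> exp (- ln (real k) - ln (8 / (\<eta> * d / 2) ^ 3))" by (simp add: c_def)
      also have "\<dots> = (\<eta> * d / 2) ^ 3 / (8 * k)"
        using k \<eta>(1) d by (simp add: exp_diff exp_minus field_simps)
      finally show "exp (- ln (real k) - c) \<le> (\<eta> * d / 2) ^ 3 / (8 * k)" .
    qed simp
    also have "\<dots> \<le> ((w * p) ^ 3 / (8 * k)) ^ k"
      using wp_ge \<eta>(1) d by (intro power_mono divide_right_mono) auto
    also have "\<dots> = ((w * p) ^ 3 / (4 * k)) ^ k * (1/2) ^ k" by (simp add: power_mult_distrib[symmetric])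
    also have "\<dots> \<le> ((w * p) ^ 3 / (4 * k)) ^ k * (1/2) ^ 1"
      using p k(1) by (intro mult_left_mono power_decreasing) auto
    also have "\<dots> = (w ^ 3 / (4 * k)) ^ k * (p ^ (3 * k) * (1/2))"
      by (simp add: power_mult_distrib power_divide power_mult)
    also note 1
    finally show "exp (- real k * ln (real k) - c * real k) \<le> prob_triangles_ge n (d / n) k"
      by (simp add: p_def)
  qed
  moreover have "0 < c" by (simp add: c_def)
  ultimately show ?thesis by blast
qed

section \<open>Lower bound from a clique\<close>

lemma cube_le_choose_three: "u ^ 3 \<le> 6 * ((u + 2) choose 3)"
proof (induction u)
  case (Suc u)
  have "(Suc u + 2) choose 3 = ((u + 2) choose 3) + ((u + 2) choose 2)"
    by (simp add: numeral_3_eq_3 numeral_2_eq_2)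
  moreover have "2 * ((u + 2) choose 2) = (u + 2) * (u + 1)" by (simp add: choose_two)
  ultimately have "6 * ((Suc u + 2) choose 3) = 6 * ((u + 2) choose 3) + 3 * ((u + 2) * (u + 1))" by linarith
  moreover have "Suc u ^ 3 \<le> u ^ 3 + 3 * ((u + 2) * (u + 1))" by (simp add: algebra_simps power3_eq_cube)
  ultimately show ?case using Suc by linarith
qed simp

lemma prob_triangles_ge_clique:
  fixes p :: real
  assumes "0 \<le> p" "p \<le> 1" "s \<le> n" "k \<le> s choose 3"
  shows "p ^ (s choose 2) \<le> prob_triangles_ge n p k"
proof -
  have "p ^ (s choose 2) = measure_pmf.prob (gnp n p) {G. pairs {..<s} \<subseteq> G}"
    using assms by (subst prob_gnp_superset) (auto simp: card_pairs intro!: pairs_mono)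
  also have "\<dots> \<le> prob_triangles_ge n p k"
    unfolding prob_triangles_ge_def
  proof (rule measure_pmf.finite_measure_mono)
    show "{G. pairs {..<s} \<subseteq> G} \<subseteq> {G. k \<le> num_triangles {..<n} G}"
    proof clarify
      fix G :: "nat set set" assume G: "pairs {..<s} \<subseteq> G"
      have "s choose 3 = card {T. T \<subseteq> {..<s} \<and> card T = 3}" by (simp add: n_subsets)
      also have "\<dots> \<le> num_triangles {..<n} G"
        unfolding num_triangles_def
      proof (rule card_mono)
        show "finite {T. T \<subseteq> {..<n} \<and> card T = 3 \<and> pairs T \<subseteq> G}"
          by (rule finite_subset[of _ "Pow {..<n}"]) auto
        show "{T. T \<subseteq> {..<s} \<and> card T = 3} \<subseteq> {T. T \<subseteq> {..<n} \<and> card T = 3 \<and> pairs T \<subseteq> G}"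
        proof clarify
          fix T assume "T \<subseteq> {..<s}" "card T = 3"
          moreover from this have "pairs T \<subseteq> G" using G pairs_mono[of T "{..<s}"] by blast
          ultimately show "T \<subseteq> {..<n} \<and> card T = 3 \<and> pairs T \<subseteq> G" using assms(3) by auto
        qed
      qed
      finally show "k \<le> num_triangles {..<n} G" using assms(4) by simp
    qed
  qed simp
  finally show ?thesis .
qed

text \<open>The clique has \<open>s = \<lceil>(6 * k) powr (1/3)\<rceil> + 2\<close> vertices: then \<open>s choose 3\<close> is at least \<open>(s - 2) ^ 3 / 6 \<ge> k\<close>, while the number of edges is
  only \<open>O(k powr (1/3))\<close> above \<open>clique_const * k powr (2/3)\<close>.\<close>

lemma lower_tail_clique:
  fixes d \<epsilon> :: real
  assumes d: "0 < d" and \<epsilon>: "0 < \<epsilon>"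
  shows "\<exists>k0. \<forall>\<^sub>F n in sequentially. \<forall>k\<ge>k0. real k \<le> sqrt (real n) \<longrightarrow>
    real n powr (- (clique_const + \<epsilon>) * real k powr (2/3)) \<le> prob_triangles_ge n (d / n) k"
proof -
  define k0 where "k0 = nat \<lceil>(22 / \<epsilon>) ^ 3\<rceil> + 1"
  have k0: "(22 / \<epsilon>) ^ 3 \<le> k0" "0 < k0" unfolding k0_def by linarith+
  have ev: "\<forall>\<^sub>F n in sequentially. 5 \<le> real n powr (1/2) \<and> d \<le> real n \<and> - ln d * (4 + \<epsilon>) / \<epsilon> \<le> ln (real n) \<and> 0 < n"
    by (intro eventually_conj eventually_real_ge eventually_powr_ge eventually_ln_ge eventually_gt_at_top) auto
  have "\<forall>\<^sub>F n in sequentially. \<forall>k\<ge>k0. real k \<le> sqrt (real n) \<longrightarrow>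
    real n powr (- (clique_const + \<epsilon>) * real k powr (2/3)) \<le> prob_triangles_ge n (d / n) k"
    using ev
  proof (eventually_elim, intro allI impI)
    fix n k :: nat
    assume "5 \<le> real n powr (1/2) \<and> d \<le> real n \<and> - ln d * (4 + \<epsilon>) / \<epsilon> \<le> ln (real n) \<and> 0 < n"
      and k: "k0 \<le> k" "real k \<le> sqrt (real n)"
    then have n: "5 \<le> sqrt n" "d \<le> real n" "- ln d * (4 + \<epsilon>) / \<epsilon> \<le> ln (real n)" "0 < n"
      by (auto simp: powr_half_sqrt)
    have kpos: "0 < k" using k k0 by linarith
    define z where "z = real k powr (1/3)"
    have z3: "z ^ 3 = k" using kpos by (simp add: z_def powr_powr flip: powr_numeral)
    have z2: "real k powr (2/3) = z\<^sup>2" using kpos by (simp add: z_def powr_powr flip: powr_numeral)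
    have z1: "1 \<le> z" using kpos by (simp add: z_def ge_one_powr_ge_zero)
    have zk: "z \<le> k"
    proof -
      have "z ^ 1 \<le> z ^ 3" using z1 by (intro power_increasing) auto
      then show ?thesis using z3 by simp
    qed
    have "(22 / \<epsilon>) ^ 3 \<le> z ^ 3" using k0(1) k(1) unfolding z3 by linarith
    then have z22: "22 / \<epsilon> \<le> z" using power_mono_iff[of "22 / \<epsilon>" z 3] z1 \<epsilon> by simp
    define y where "y = (6::real) powr (1/3) * z"
    have six: "((6::real) powr (1/3)) ^ 3 = 6" by (simp add: powr_powr flip: powr_numeral)
    have y3: "y ^ 3 = 6 * k" by (simp only: y_def power_mult_distrib six z3)
    have six2: "((6::real) powr (1/3))\<^sup>2 = 2 * clique_const"
    proof -
      have "(((6::real) powr (1/3))\<^sup>2) ^ 3 = (((6::real) powr (1/3)) ^ 3) ^ 2" by (simp only: power_mult[symmetric] mult.commute)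
      also have "\<dots> = (2 * clique_const) ^ 3" by (simp only: six power_mult_distrib clique_const_cubed) simp
      finally show ?thesis using clique_const_bounds by (subst (asm) power_eq_iff_eq_base) auto
    qed
    have y2: "y\<^sup>2 = 2 * clique_const * z\<^sup>2" by (simp only: y_def power_mult_distrib six2)
    have ypos: "0 \<le> y" using z1 by (simp add: y_def)
    have yz: "y \<le> 2 * z"
    proof -
      have "y ^ 3 \<le> (2 * z) ^ 3" by (simp add: y3 power_mult_distrib z3)
      then show ?thesis using power_mono_iff[of y "2 * z" 3] ypos z1 by simp
    qed
    define u where "u = nat \<lceil>y\<rceil>"
    have u: "y \<le> u" "u \<le> y + 1" using ypos unfolding u_def by linarith+
    define s where "s = u + 2"
    have "k \<le> s choose 3"
    proof -
      have "y ^ 3 \<le> real u ^ 3" using u(1) ypos by (intro power_mono)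
      then have "6 * real k \<le> real u ^ 3" by (simp only: y3)
      also have "\<dots> = real (u ^ 3)" by simp
      also have "\<dots> \<le> real (6 * (s choose 3))" unfolding s_def by (intro of_nat_mono cube_le_choose_three)
      finally show ?thesis by simp
    qed
    moreover have "s \<le> n"
    proof -
      have "real s \<le> 5 * real k" using u yz zk z1 kpos unfolding s_def by simp
      also have "\<dots> \<le> sqrt n * sqrt n" using n(1) k(2) by (intro mult_mono) auto
      finally show ?thesis by simp
    qed
    ultimately have P: "(d / n) ^ (s choose 2) \<le> prob_triangles_ge n (d / n) k"
      using d n by (intro prob_triangles_ge_clique) auto
    have b: "real (s choose 2) \<le> (clique_const + \<epsilon> / 2) * z\<^sup>2"
    proof -
      have "2 * (s choose 2) \<le> s * (s - 1)" unfolding choose_two by simp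
      also have "\<dots> \<le> s * s" by simp
      finally have "real (2 * (s choose 2)) \<le> real (s * s)" by (rule of_nat_mono)
      then have "2 * real (s choose 2) \<le> real s * real s" by simp
      also have "\<dots> \<le> (y + 3) * (y + 3)" using u ypos by (intro mult_mono) (auto simp: s_def)
      also have "\<dots> = 2 * clique_const * z\<^sup>2 + 6 * y + 9" using y2 by (simp add: algebra_simps power2_eq_square)
      also have "\<dots> \<le> 2 * clique_const * z\<^sup>2 + 22 * z" using yz z1 by simp
      also have "22 * z \<le> \<epsilon> * z\<^sup>2"
      proof -
        have "22 \<le> \<epsilon> * z" using z22 \<epsilon> by (simp add: field_simps)
        then have "22 * z \<le> \<epsilon> * z * z" using z1 by (intro mult_right_mono) auto
        then show ?thesis by (simp add: power2_eq_square)
      qed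
      finally show ?thesis by (simp add: algebra_simps)
    qed
    \<comment> \<open>The relative error from \<open>d\<close>, chosen such that \<open>(2 + \<epsilon>/2) * \<epsilon>' = \<epsilon>/2\<close>.\<close>
    define \<epsilon>' where "\<epsilon>' = \<epsilon> / (4 + \<epsilon>)"
    have lnn: "0 \<le> ln (real n)" using n(4) by simp
    have "- ln d \<le> \<epsilon>' * ln n" using n(3) \<epsilon> by (simp add: \<epsilon>'_def field_simps)
    then have ln_le: "ln n - ln d \<le> (1 + \<epsilon>') * ln n" by (simp add: algebra_simps)
    have "(s choose 2) * (ln n - ln d) \<le> (s choose 2) * ((1 + \<epsilon>') * ln n)" using ln_le by (intro mult_left_mono) auto
    also have "\<dots> \<le> (clique_const + \<epsilon> / 2) * z\<^sup>2 * ((1 + \<epsilon>') * ln n)"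
      using b lnn \<epsilon> by (intro mult_right_mono) (auto simp: \<epsilon>'_def)
    also have "\<dots> = ((clique_const + \<epsilon> / 2) * (1 + \<epsilon>')) * (z\<^sup>2 * ln n)" by simp
    also have "\<dots> \<le> (clique_const + \<epsilon>) * (z\<^sup>2 * ln n)"
    proof (rule mult_right_mono)
      have "(clique_const + \<epsilon> / 2) * \<epsilon>' \<le> (2 + \<epsilon> / 2) * \<epsilon>'"
        using clique_const_bounds \<epsilon> by (intro mult_right_mono) (auto simp: \<epsilon>'_def)
      also have "\<dots> = \<epsilon> / 2" using \<epsilon> by (simp add: \<epsilon>'_def field_simps)
      finally show "(clique_const + \<epsilon> / 2) * (1 + \<epsilon>') \<le> clique_const + \<epsilon>"
        unfolding distrib_left mult_1_right by linarith
    qed (use lnn in auto)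
    finally have "exp (- ((clique_const + \<epsilon>) * (z\<^sup>2 * ln n))) \<le> exp (- ((s choose 2) * (ln n - ln d)))" by simp
    also have "\<dots> = exp ((s choose 2) * (ln d - ln n))" by (simp add: algebra_simps)
    also have "\<dots> = (d / n) ^ (s choose 2)" using d n(4) by (simp add: exp_of_nat_mult exp_diff)
    also note P
    finally show "real n powr (- (clique_const + \<epsilon>) * real k powr (2/3)) \<le> prob_triangles_ge n (d / n) k"
      unfolding z2 powr_neg_mult[OF n(4)] .
  qed
  then show ?thesis by blast
qed

section \<open>The two regimes\<close>

lemma eventually_small_of_cube_root_log:
  "\<forall>\<^sub>F n in sequentially. \<forall>k. 0 < k \<longrightarrow> real k powr (1/3) * ln (real k) \<le> 2 * ln (real n) \<longrightarrow>
    real k \<le> real n powr (1/10 - 1/20)"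
proof -
  have "\<forall>\<^sub>F n in sequentially. (2 * ln (real n)) ^ 3 + 3 \<le> real n powr (1/20)" by real_asymp
  then have "\<forall>\<^sub>F n in sequentially. (2 * ln (real n)) ^ 3 + 3 \<le> real n powr (1/20) \<and> 0 < n"
    by (intro eventually_conj eventually_gt_at_top)
  then show ?thesis
  proof (eventually_elim, intro allI impI)
    fix n k :: nat
    assume n: "(2 * ln (real n)) ^ 3 + 3 \<le> real n powr (1/20) \<and> 0 < n"
      and k: "0 < k" "real k powr (1/3) * ln (real k) \<le> 2 * ln (real n)"
    have "real k \<le> (2 * ln (real n)) ^ 3 + 3"
    proof (cases "k \<le> 3")
      case True
      moreover have "0 \<le> ln (real n)" using n by simp
      then have "0 \<le> (2 * ln (real n)) ^ 3" by simp
      ultimately show ?thesis by linarith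
    next
      case False
      then have "exp 1 \<le> real k" using exp_le by linarith
      then have "1 \<le> ln (real k)" using k(1) by (simp add: ln_ge_iff)
      then have "real k powr (1/3) * 1 \<le> real k powr (1/3) * ln (real k)" by (intro mult_left_mono) auto
      then have "real k powr (1/3) \<le> 2 * ln (real n)" using k(2) by linarith
      then have "(real k powr (1/3)) ^ 3 \<le> (2 * ln (real n)) ^ 3" by (intro power_mono) auto
      then show ?thesis using k(1) by (simp add: powr_powr flip: powr_numeral)
    qed
    then show "real k \<le> real n powr (1/10 - 1/20)" using n by simp
  qed
qed

lemma eventually_ge_of_cube_root_log:
  fixes k :: "nat \<Rightarrow> nat" and a :: real
  assumes "1 \<le> a" "\<And>n. 0 < k n"
    and "\<forall>\<^sub>F n in sequentially. a * ln (real n) < real (k n) powr (1/3) * ln (real (k n))"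
  shows "\<forall>\<^sub>F n in sequentially. K \<le> real (k n)"
proof -
  have "\<forall>\<^sub>F n in sequentially. max 0 (K powr (1/3) * ln K) \<le> ln (real n)" by (rule eventually_ln_ge)
  with assms(3) show ?thesis
  proof eventually_elim
    fix n
    assume n: "a * ln (real n) < real (k n) powr (1/3) * ln (real (k n))" "max 0 (K powr (1/3) * ln K) \<le> ln (real n)"
    show "K \<le> real (k n)"
    proof (rule ccontr)
      assume "\<not> K \<le> real (k n)"
      then have "real (k n) powr (1/3) * ln (real (k n)) \<le> K powr (1/3) * ln K"
        using assms(2)[of n] by (intro mult_mono powr_mono2) auto
      moreover have "1 * ln (real n) \<le> a * ln (real n)" using n(2) assms(1) by (intro mult_right_mono) auto
      ultimately show False using n by linarith
    qed
  qed
qed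

text \<open>Here a triangle may be charged the full rate \<open>r = ln k\<close>, and the error \<open>d ^ 3 * exp r\<close> is \<open>d ^ 3 * k\<close>, with a constant that
  depends on \<open>d\<close> only.  The hypothesis makes \<open>k\<close> polylogarithmic in \<open>n\<close>, so \<open>1/20\<close> is an arbitrary choice of the exponent
  \<open>\<mu>\<close>.\<close>

lemma poisson_regime:
  fixes d :: real
  assumes d: "0 < d"
  shows "\<exists>c>0. \<forall>\<epsilon>. 0 < \<epsilon> \<longrightarrow> \<epsilon> < clique_const \<longrightarrow>
    (\<forall>\<^sub>F n in sequentially. \<forall>k. 0 < k \<longrightarrow>
      real k powr (1/3) * ln (real k) < (clique_const - \<epsilon>) * ln (real n) \<longrightarrow>
      exp (- real k * ln (real k) - c * real k) \<le> prob_triangles_ge n (d / n) k \<and>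
      prob_triangles_ge n (d / n) k \<le> exp (- real k * ln (real k) + c * real k))"
proof -
  obtain c where c: "0 < c" and lower: "\<forall>\<^sub>F n in sequentially. \<forall>k. 0 < k \<longrightarrow> real k \<le> sqrt (real n) \<longrightarrow>
    exp (- real k * ln (real k) - c * real k) \<le> prob_triangles_ge n (d / n) k"
    using lower_tail_disjoint[OF d] by blast
  define c' where "c' = max c (d ^ 3)"
  have "\<forall>\<^sub>F n in sequentially. \<forall>k. 0 < k \<longrightarrow>
      real k powr (1/3) * ln (real k) < (clique_const - \<epsilon>) * ln (real n) \<longrightarrow>
      exp (- real k * ln (real k) - c' * real k) \<le> prob_triangles_ge n (d / n) k \<and>
      prob_triangles_ge n (d / n) k \<le> exp (- real k * ln (real k) + c' * real k)"
    if \<epsilon>: "0 < \<epsilon>" "\<epsilon> < clique_const" for \<epsilon>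
  proof -
    have "(0::real) < 1/20" by simp
    note upper = upper_tail[OF d \<epsilon> this]
    show ?thesis
      using lower upper eventually_small_of_cube_root_log eventually_gt_at_top[of 0]
    proof (eventually_elim, intro allI impI)
      fix n k :: nat
      assume l: "\<forall>k. 0 < k \<longrightarrow> real k \<le> sqrt (real n) \<longrightarrow>
          exp (- real k * ln (real k) - c * real k) \<le> prob_triangles_ge n (d / n) k"
        and u: "\<forall>k r. 0 < k \<longrightarrow> real k \<le> real n powr (1/10 - 1/20) \<longrightarrow>
          0 \<le> r \<longrightarrow> r \<le> ln (real k) \<longrightarrow> r \<le> (clique_const - \<epsilon>) * ln (real n) / real k powr (1/3) \<longrightarrow>
          prob_triangles_ge n (d / n) k \<le> exp (- real k * r + d ^ 3 * exp r)"
        and s: "\<forall>k. 0 < k \<longrightarrow> real k powr (1/3) * ln (real k) \<le> 2 * ln (real n) \<longrightarrow>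
          real k \<le> real n powr (1/10 - 1/20)"
        and n: "0 < n" and k: "0 < k"
        and hyp: "real k powr (1/3) * ln (real k) < (clique_const - \<epsilon>) * ln (real n)"
      have "(clique_const - \<epsilon>) * ln (real n) \<le> 2 * ln (real n)"
        using n clique_const_bounds \<epsilon> by (intro mult_right_mono) auto
      then have small: "real k \<le> real n powr (1/10 - 1/20)" using s k hyp by auto
      also have "\<dots> \<le> real n powr (1/2)" using n by (intro powr_mono) auto
      finally have "real k \<le> sqrt n" using n by (simp add: powr_half_sqrt)
      then have "exp (- real k * ln (real k) - c * real k) \<le> prob_triangles_ge n (d / n) k"
        using l k by blast
      moreover have "exp (- real k * ln (real k) - c' * real k) \<le> exp (- real k * ln (real k) - c * real k)"
        by (simp add: c'_def mult_right_mono)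
      moreover have "prob_triangles_ge n (d / n) k \<le> exp (- real k * ln (real k) + d ^ 3 * exp (ln (real k)))"
      proof -
        have "ln (real k) \<le> (clique_const - \<epsilon>) * ln (real n) / real k powr (1/3)"
          using hyp k by (simp add: field_simps)
        moreover have "0 \<le> ln (real k)" using k by simp
        ultimately show ?thesis using u k small by blast
      qed
      moreover have "d ^ 3 * exp (ln (real k)) \<le> c' * real k"
        using k by (simp add: c'_def mult_right_mono)
      then have "exp (- real k * ln (real k) + d ^ 3 * exp (ln (real k))) \<le> exp (- real k * ln (real k) + c' * real k)"
        by simp
      ultimately show "exp (- real k * ln (real k) - c' * real k) \<le> prob_triangles_ge n (d / n) k \<and>
          prob_triangles_ge n (d / n) k \<le> exp (- real k * ln (real k) + c' * real k)"
        by linarith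
    qed
  qed
  moreover have "0 < c'" using c by (simp add: c'_def)
  ultimately show ?thesis by blast
qed

text \<open>The error \<open>A * exp r\<close> is of lower order than the main term.  With \<open>y = l / k powr (1/3)\<close>, the main term is \<open>k * y\<close> up to constants.  For
  \<open>y \<le> 1\<close> the rate is bounded, and the main term is at least \<open>\<epsilon> * l\<close>.  For \<open>y > 1\<close>, the gap \<open>\<delta>\<close> above the threshold keeps the
  rate below a fixed fraction \<open>q < 1\<close> of \<open>ln k\<close>, so that \<open>exp r\<close> is at most \<open>k powr q\<close>.\<close>

lemma exp_rate_le:
  fixes A c \<delta> \<epsilon> k l y r :: real
  assumes "0 < A" "1 < c" "c < 2" "0 < \<epsilon>" "\<epsilon> < c" "0 < \<delta>" "1 \<le> k" "1 \<le> l"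
    and y: "y = l / k powr (1/3)" and r: "r = (c - \<epsilon>) * y" and hyp: "(c + \<delta>) * y \<le> ln k"
    and l: "9 * A / \<epsilon> \<le> l" and k: "A / \<epsilon> \<le> k powr (1 - (c - \<epsilon>) / (c + \<delta>))"
  shows "A * exp r \<le> \<epsilon> * k powr (2/3) * l"
proof -
  have ky: "k powr (2/3) * l = k * y"
    unfolding y using assms(7) by (rule powr_two_thirds_mult)
  show ?thesis
  proof (cases "y \<le> 1")
    case True
    have "0 \<le> y" using assms by (simp add: y)
    then have "r \<le> 2 * 1" unfolding r using True assms by (intro mult_mono) auto
    then have "exp r \<le> exp 1 * exp 1" by (simp flip: exp_add)
    also have "\<dots> \<le> 3 * 3" using exp_le by (intro mult_mono) auto
    finally have "A * exp r \<le> 9 * A" using assms(1) by simp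
    also have "\<dots> \<le> \<epsilon> * l" using l assms by (simp add: field_simps)
    also have "\<dots> \<le> \<epsilon> * k powr (2/3) * l"
      using assms by (intro mult_right_mono) (auto simp: mult_le_cancel_left1 ge_one_powr_ge_zero)
    finally show ?thesis .
  next
    case False
    define q where "q = (c - \<epsilon>) / (c + \<delta>)"
    have "r = q * ((c + \<delta>) * y)" using assms by (simp add: r q_def)
    also have "\<dots> \<le> q * ln k" using hyp assms by (intro mult_left_mono) (auto simp: q_def)
    finally have "exp r \<le> k powr q" using assms by (simp add: powr_def)
    then have "A * exp r \<le> A * k powr q" using assms by simp
    also have "\<dots> \<le> (\<epsilon> * k powr (1 - q)) * k powr q"
      using k assms by (intro mult_right_mono) (auto simp: q_def field_simps)
    also have "\<dots> = \<epsilon> * k" using assms by (simp add: powr_diff)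
    also have "\<dots> \<le> \<epsilon> * (k * y)"
      using False assms(4,7) mult_left_mono[of 1 y "\<epsilon> * k"] by (simp add: mult.assoc)
    finally show ?thesis by (simp only: ky mult.assoc)
  qed
qed

text \<open>The rate is \<open>r = (clique_const - e) * ln n / k powr (1/3)\<close>, for which \<open>k * r\<close> is the desired exponent; it stays below \<open>ln k\<close>
  above the threshold.\<close>

lemma clique_regime:
  fixes d \<delta> \<mu> \<epsilon> :: real and k :: "nat \<Rightarrow> nat"
  assumes d: "0 < d" and \<delta>: "0 < \<delta>" and \<mu>: "0 < \<mu>" and kpos: "\<And>n. 0 < k n"
    and hyp: "\<forall>\<^sub>F n in sequentially. (clique_const + \<delta>) * ln (real n) < real (k n) powr (1/3) * ln (real (k n)) \<and>
      real (k n) \<le> real n powr (1/10 - \<mu>)"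
    and \<epsilon>: "0 < \<epsilon>"
  shows "\<forall>\<^sub>F n in sequentially.
    real n powr (- (clique_const + \<epsilon>) * real (k n) powr (2/3)) \<le> prob_triangles_ge n (d / n) (k n) \<and>
    prob_triangles_ge n (d / n) (k n) \<le> real n powr (- (clique_const - \<epsilon>) * real (k n) powr (2/3))"
proof -
  have "\<forall>\<^sub>F n in sequentially. (clique_const + \<delta>) * ln (real n) < real (k n) powr (1/3) * ln (real (k n))"
    using hyp by eventually_elim simp
  then have klarge: "\<forall>\<^sub>F n in sequentially. K \<le> real (k n)" for K
    using clique_const_bounds \<delta> kpos by (intro eventually_ge_of_cube_root_log) auto
  obtain k0 where lower: "\<forall>\<^sub>F n in sequentially. \<forall>k\<ge>k0. real k \<le> sqrt (real n) \<longrightarrow>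
    real n powr (- (clique_const + \<epsilon>) * real k powr (2/3)) \<le> prob_triangles_ge n (d / n) k"
    using lower_tail_clique[OF d \<epsilon>] by blast
  define e where "e = min \<epsilon> 1 / 2"
  have e: "0 < e" "e < clique_const" "2 * e \<le> \<epsilon>" using \<epsilon> clique_const_bounds by (auto simp: e_def)
  define q where "q = 1 - (clique_const - e) / (clique_const + \<delta>)"
  have q: "0 < q" using e \<delta> clique_const_bounds by (simp add: q_def field_simps)
  show ?thesis
    using hyp lower upper_tail[OF d e(1,2) \<mu>] klarge[of "real k0"] klarge[of "max 1 (d ^ 3 / e) powr (1 / q)"]
      eventually_ln_ge[of "max 1 (9 * d ^ 3 / e)"] eventually_gt_at_top[of 0]
  proof eventually_elim
    fix n :: nat
    assume h: "(clique_const + \<delta>) * ln (real n) < real (k n) powr (1/3) * ln (real (k n)) \<and>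
        real (k n) \<le> real n powr (1/10 - \<mu>)"
      and l: "\<forall>k\<ge>k0. real k \<le> sqrt (real n) \<longrightarrow>
        real n powr (- (clique_const + \<epsilon>) * real k powr (2/3)) \<le> prob_triangles_ge n (d / n) k"
      and u: "\<forall>k r. 0 < k \<longrightarrow> real k \<le> real n powr (1/10 - \<mu>) \<longrightarrow>
        0 \<le> r \<longrightarrow> r \<le> ln (real k) \<longrightarrow> r \<le> (clique_const - e) * ln (real n) / real k powr (1/3) \<longrightarrow>
        prob_triangles_ge n (d / n) k \<le> exp (- real k * r + d ^ 3 * exp r)"
      and k0: "real k0 \<le> real (k n)" and kq: "max 1 (d ^ 3 / e) powr (1 / q) \<le> real (k n)"
      and ln: "max 1 (9 * d ^ 3 / e) \<le> ln (real n)" and n: "0 < n"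
    define y where "y = ln (real n) / real (k n) powr (1/3)"
    define r where "r = (clique_const - e) * y"
    have k1: "1 \<le> real (k n)" using kpos[of n] by linarith
    have y: "0 \<le> y" using ln by (simp add: y_def)
    have hy: "(clique_const + \<delta>) * y \<le> ln (real (k n))"
      using h k1 by (simp add: y_def field_simps)
    have low: "real n powr (- (clique_const + \<epsilon>) * real (k n) powr (2/3)) \<le> prob_triangles_ge n (d / n) (k n)"
    proof -
      have "real n powr (1/10 - \<mu>) \<le> real n powr (1/2)" using n \<mu> by (intro powr_mono) auto
      then have "real (k n) \<le> sqrt n" using h n by (simp add: powr_half_sqrt)
      then show ?thesis using l k0 by simp
    qed
    have "d ^ 3 / e \<le> max 1 (d ^ 3 / e)" by simp
    also have "\<dots> = (max 1 (d ^ 3 / e) powr (1 / q)) powr q" using q by (simp add: powr_powr)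
    also have "\<dots> \<le> real (k n) powr q" using kq q by (intro powr_mono2) auto
    finally have "d ^ 3 * exp r \<le> e * real (k n) powr (2/3) * ln (real n)"
      using d e \<delta> clique_const_bounds k1 ln hy
      by (intro exp_rate_le[where y = y and c = clique_const and \<delta> = \<delta>]) (auto simp: q_def y_def r_def)
    moreover have "real (k n) * r = (clique_const - e) * real (k n) powr (2/3) * ln (real n)"
      unfolding r_def y_def mult.assoc powr_two_thirds_mult[OF k1] by (rule mult.left_commute)
    moreover have "prob_triangles_ge n (d / n) (k n) \<le> exp (- real (k n) * r + d ^ 3 * exp r)"
    proof -
      have "r \<le> (clique_const + \<delta>) * y" unfolding r_def using y e \<delta> by (intro mult_right_mono) auto
      then have "r \<le> ln (real (k n))" using hy by linarith
      moreover have "0 \<le> r" using y e by (simp add: r_def)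
      moreover have "r \<le> (clique_const - e) * ln (real n) / real (k n) powr (1/3)" by (simp add: r_def y_def)
      ultimately show ?thesis using u kpos h by blast
    qed
    moreover have "(clique_const - \<epsilon>) * (real (k n) powr (2/3) * ln (real n))
        \<le> (clique_const - 2 * e) * (real (k n) powr (2/3) * ln (real n))"
      using e(3) ln by (intro mult_right_mono) auto
    ultimately have "prob_triangles_ge n (d / n) (k n)
        \<le> exp (- ((clique_const - \<epsilon>) * (real (k n) powr (2/3) * ln (real n))))"
      by (elim order_trans) (simp add: algebra_simps)
    also have "\<dots> = real n powr (- (clique_const - \<epsilon>) * real (k n) powr (2/3))"
      using n by (simp only: powr_neg_mult)
    finally show "real n powr (- (clique_const + \<epsilon>) * real (k n) powr (2/3)) \<le> prob_triangles_ge n (d / n) (k n) \<and>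
      prob_triangles_ge n (d / n) (k n) \<le> real n powr (- (clique_const - \<epsilon>) * real (k n) powr (2/3))"
      using low by simp
  qed
qed

theorem theorem1p1:
  fixes d :: real
  assumes "d > 0"
  shows
    "(\<exists>c>0. \<exists>\<delta>0>0. \<forall>\<delta>::real. 0 < \<delta> \<and> \<delta> < \<delta>0 \<longrightarrow>
        (\<forall>k :: nat \<Rightarrow> nat. mono k \<and> (\<forall>n. k n > 0) \<and>
          (\<forall>\<^sub>F n in sequentially.
             real (k n) powr (1/3) * ln (real (k n))
               < ((3 / sqrt 2) powr (2/3) - \<delta>) * ln (real n)) \<longrightarrow>
          (\<forall>\<^sub>F n in sequentially.
             exp (- real (k n) * ln (real (k n)) - c * real (k n))
               \<le> prob_triangles_ge n (d / real n) (k n) \<and>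
             prob_triangles_ge n (d / real n) (k n)
               \<le> exp (- real (k n) * ln (real (k n)) + c * real (k n)))))
     \<and>
     (\<forall>\<delta> \<mu> :: real. \<forall>k :: nat \<Rightarrow> nat.
        0 < \<delta> \<and> 0 < \<mu> \<and> \<mu> < 1/10 \<and> mono k \<and> (\<forall>n. k n > 0) \<and>
        (\<forall>\<^sub>F n in sequentially.
           real (k n) powr (1/3) * ln (real (k n))
             > ((3 / sqrt 2) powr (2/3) + \<delta>) * ln (real n) \<and>
           real (k n) \<le> real n powr (1/10 - \<mu>)) \<longrightarrow>
        (\<forall>\<epsilon>::real. \<epsilon> > 0 \<longrightarrow>
          (\<forall>\<^sub>F n in sequentially.
             real n powr (- ((3 / sqrt 2) powr (2/3) + \<epsilon>) * real (k n) powr (2/3))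
               \<le> prob_triangles_ge n (d / real n) (k n) \<and>
             prob_triangles_ge n (d / real n) (k n)
               \<le> real n powr (- ((3 / sqrt 2) powr (2/3) - \<epsilon>) * real (k n) powr (2/3)))))"
proof (intro conjI)
  obtain c where "c > 0" and c: "\<forall>\<epsilon>. 0 < \<epsilon> \<longrightarrow> \<epsilon> < clique_const \<longrightarrow>
    (\<forall>\<^sub>F n in sequentially. \<forall>k. 0 < k \<longrightarrow>
      real k powr (1/3) * ln (real k) < (clique_const - \<epsilon>) * ln (real n) \<longrightarrow>
      exp (- real k * ln (real k) - c * real k) \<le> prob_triangles_ge n (d / n) k \<and>
      prob_triangles_ge n (d / n) k \<le> exp (- real k * ln (real k) + c * real k))"
    using poisson_regime[OF assms] by blast
  show "\<exists>c>0. \<exists>\<delta>0>0. \<forall>\<delta>::real. 0 < \<delta> \<and> \<delta> < \<delta>0 \<longrightarrow>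
        (\<forall>k :: nat \<Rightarrow> nat. mono k \<and> (\<forall>n. k n > 0) \<and>
          (\<forall>\<^sub>F n in sequentially.
             real (k n) powr (1/3) * ln (real (k n))
               < ((3 / sqrt 2) powr (2/3) - \<delta>) * ln (real n)) \<longrightarrow>
          (\<forall>\<^sub>F n in sequentially.
             exp (- real (k n) * ln (real (k n)) - c * real (k n))
               \<le> prob_triangles_ge n (d / real n) (k n) \<and>
             prob_triangles_ge n (d / real n) (k n)
               \<le> exp (- real (k n) * ln (real (k n)) + c * real (k n))))"
    unfolding clique_const_def[symmetric]
  proof (rule exI[of _ c], rule conjI[OF \<open>c > 0\<close>], rule exI[of _ clique_const], intro conjI allI impI; (elim conjE)?)
    show "0 < clique_const" using clique_const_bounds by simp
    fix \<delta> :: real and k :: "nat \<Rightarrow> nat"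
    assume "0 < \<delta>" "\<delta> < clique_const" "\<forall>n. 0 < k n"
      and hyp: "\<forall>\<^sub>F n in sequentially.
        real (k n) powr (1/3) * ln (real (k n)) < (clique_const - \<delta>) * ln (real n)"
    with c have "\<forall>\<^sub>F n in sequentially. \<forall>k. 0 < k \<longrightarrow>
      real k powr (1/3) * ln (real k) < (clique_const - \<delta>) * ln (real n) \<longrightarrow>
      exp (- real k * ln (real k) - c * real k) \<le> prob_triangles_ge n (d / n) k \<and>
      prob_triangles_ge n (d / n) k \<le> exp (- real k * ln (real k) + c * real k)" by blast
    with hyp show "\<forall>\<^sub>F n in sequentially.
        exp (- real (k n) * ln (real (k n)) - c * real (k n)) \<le> prob_triangles_ge n (d / real n) (k n) \<and>
        prob_triangles_ge n (d / real n) (k n) \<le> exp (- real (k n) * ln (real (k n)) + c * real (k n))"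
      by eventually_elim (use \<open>\<forall>n. 0 < k n\<close> in blast)
  qed
next
  show "\<forall>\<delta> \<mu> :: real. \<forall>k :: nat \<Rightarrow> nat.
        0 < \<delta> \<and> 0 < \<mu> \<and> \<mu> < 1/10 \<and> mono k \<and> (\<forall>n. k n > 0) \<and>
        (\<forall>\<^sub>F n in sequentially.
           real (k n) powr (1/3) * ln (real (k n))
             > ((3 / sqrt 2) powr (2/3) + \<delta>) * ln (real n) \<and>
           real (k n) \<le> real n powr (1/10 - \<mu>)) \<longrightarrow>
        (\<forall>\<epsilon>::real. \<epsilon> > 0 \<longrightarrow>
          (\<forall>\<^sub>F n in sequentially.
             real n powr (- ((3 / sqrt 2) powr (2/3) + \<epsilon>) * real (k n) powr (2/3))
               \<le> prob_triangles_ge n (d / real n) (k n) \<and>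
             prob_triangles_ge n (d / real n) (k n)
               \<le> real n powr (- ((3 / sqrt 2) powr (2/3) - \<epsilon>) * real (k n) powr (2/3))))"
    unfolding clique_const_def[symmetric]
  proof (intro allI impI, elim conjE)
    fix \<delta> \<mu> \<epsilon> :: real and k :: "nat \<Rightarrow> nat"
    assume "0 < \<delta>" "0 < \<mu>" "\<forall>n. 0 < k n" "0 < \<epsilon>"
      and "\<forall>\<^sub>F n in sequentially. (clique_const + \<delta>) * ln (real n) < real (k n) powr (1/3) * ln (real (k n)) \<and>
        real (k n) \<le> real n powr (1/10 - \<mu>)"
    then show "\<forall>\<^sub>F n in sequentially.
      real n powr (- (clique_const + \<epsilon>) * real (k n) powr (2/3)) \<le> prob_triangles_ge n (d / real n) (k n) \<and>
      prob_triangles_ge n (d / real n) (k n) \<le> real n powr (- (clique_const - \<epsilon>) * real (k n) powr (2/3))"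
      using assms by (intro clique_regime) auto
  qed
qed


end
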